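(* Let $\mathrm{G}$ be a finite graph and $n\ge 0$ an integer. If there is an $\mathcal{A}_3$-algebra structure on $\mathrm{B}(n,\mathrm{G})\otimes\mathbb{Z}/3$, then $s_3\chi(\mathrm{G})\le n$.
   Context: Graphs are finite simple graphs; $\mathrm{G}$ has vertex set $\{y_1,\dots,y_m\}$ and is regarded as a simplicial complex of dimension $\le 1$. For a simplicial complex $K$ on a finite vertex set $V=\{v_1,\dots,v_N\}$ and a function $\phi:V\to 2\mathbb{Z}_{>0}$, the Stanley-Reisner ring is the graded ring $\mathrm{SR}(K,\phi)=\mathbb{Z}[v_1,\dots,v_N]/I_K$ with $|v_i|=\phi(v_i)$, where $I_K$ is generated by the monomials $v_{i_1}\cdots v_{i_k}$ (distinct $i_j$) with $\{v_{i_1},\dots,v_{i_k}\}\notin K$. $\mathrm{B}(n,\mathrm{G})=\mathrm{SR}(\Delta^{n-1}*\mathrm{G},\phi)=\mathbb{Z}[x_1,\dots,x_n,y_1,\dots,y_m]/I_{\Delta^{n-1}*\mathrm{G}}$, where $\Delta^{n-1}$ is the full simplex on the $n$ vertices $x_1,\dots,x_n$ (empty if $n=0$), $*$ is the simplicial join, $\phi(x_i)=4$ and $\phi(y_j)=8$. $\mathcal{A}_p$ is the mod-$p$ Steenrod algebra. For an odd prime $p$, an $\mathcal{A}_p$-algebra structure on a graded commutative $\mathbb{Z}/p$-algebra $R$ concentrated in even degrees means an unstable algebra structure: a left $\mathcal{A}_p$-module structure with operations $P^a:R^d\to R^{d+2a(p-1)}$, $P^0=\mathrm{id}$, satisfying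 the Adem relations, the Cartan formula, $P^a(x)=x^p$ if $|x|=2a$, and $P^a(x)=0$ if $2a>|x|$. For a field $\mathbf{k}$, an $n$-span coloring of $\mathrm{G}$ is a function $f:V(\mathrm{G})\to\mathbf{k}^n\setminus\{0\}$ such that $f(v)\notin\langle f(N(v))\rangle$ for every vertex $v$, where $N(v)$ is the set of neighbors of $v$ and $\langle\cdot\rangle$ is the $\mathbf{k}$-linear span. $s_p\chi(\mathrm{G})$ is the smallest $n$ such that $\mathrm{G}$ admits an $n$-span coloring over $\mathbf{k}=\mathbb{F}_p$. *)

theory Defs
  imports
    "HOL-Library.Poly_Mapping"
    "HOL-Algebra.QuotRing"
    "Jordan_Normal_Form.VS_Connect"
    "Berlekamp_Zassenhaus.Finite_Field"
begin

section \<open>Graded rings and Stanley--Reisner rings\<close>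

text \<open>\<open>grade R d\<close> is the set of homogeneous elements of degree \<open>d\<close>, including zero.\<close>

record 'a graded_ring = "'a ring" +
  grade :: "nat \<Rightarrow> 'a set"

text \<open>
  Integer polynomials in the variables \<open>V\<close>, the variable \<open>v\<close> having degree \<open>\<phi> v\<close>. A polynomial
  is a finitely supported map from exponent vectors to coefficients.
\<close>

definition graded_poly_ring ::
    "'v set \<Rightarrow> ('v \<Rightarrow> nat) \<Rightarrow> (('v \<Rightarrow>\<^sub>0 nat) \<Rightarrow>\<^sub>0 int) graded_ring" where
  "graded_poly_ring V \<phi> =
    \<lparr>carrier = {f. \<forall>t\<in>Poly_Mapping.keys f. Poly_Mapping.keys t \<subseteq> V},
     monoid.mult = (*), one = 1, zero = 0, add = (+),
     grade = (\<lambda>d. {f. \<forall>t\<in>Poly_Mapping.keys f. Poly_Mapping.keys t \<subseteq> V \<and>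
                        (\<Sum>v\<in>Poly_Mapping.keys t. Poly_Mapping.lookup t v * \<phi> v) = d})\<rparr>"

definition poly_var :: "'v \<Rightarrow> (('v \<Rightarrow>\<^sub>0 nat) \<Rightarrow>\<^sub>0 int)" where
  "poly_var v = Poly_Mapping.single (Poly_Mapping.single v 1) 1"

text \<open>The quotient by a homogeneous ideal, with the induced grading.\<close>

definition graded_quot :: "'a graded_ring \<Rightarrow> 'a set \<Rightarrow> 'a set graded_ring" where
  "graded_quot R I =
    ring.extend (R Quot I) (graded_ring.fields (\<lambda>d. (\<lambda>x. I +>\<^bsub>R\<^esub> x) ` grade R d))"

text \<open>A simplicial complex \<open>K\<close> on \<open>V\<close> is given by its set of faces, the empty face included.\<close>

definition SR_ideal :: "'v set \<Rightarrow> 'v set set \<Rightarrow> ('v \<Rightarrow> nat) \<Rightarrow> (('v \<Rightarrow>\<^sub>0 nat) \<Rightarrow>\<^sub>0 int) set" where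
  "SR_ideal V K \<phi> =
    genideal (graded_poly_ring V \<phi>) {\<Prod>v\<in>\<sigma>. poly_var v | \<sigma>. \<sigma> \<subseteq> V \<and> \<sigma> \<notin> K}"

definition SR :: "'v set \<Rightarrow> 'v set set \<Rightarrow> ('v \<Rightarrow> nat) \<Rightarrow> (('v \<Rightarrow>\<^sub>0 nat) \<Rightarrow>\<^sub>0 int) set graded_ring" where
  "SR V K \<phi> = graded_quot (graded_poly_ring V \<phi>) (SR_ideal V K \<phi>)"

text \<open>\<open>R \<otimes> \<int>/p\<close> for a graded ring \<open>R\<close>, in its standard form \<open>R/pR\<close>.\<close>

definition tensor_Zmod :: "'a graded_ring \<Rightarrow> nat \<Rightarrow> 'a set graded_ring" where
  "tensor_Zmod R p = graded_quot R (genideal R {[p] \<cdot>\<^bsub>R\<^esub> \<one>\<^bsub>R\<^esub>})"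


section \<open>Graphs and the rings \<open>B(n, G)\<close>\<close>

definition fin_simple_graph :: "'a set \<Rightarrow> 'a set set \<Rightarrow> bool" where
  "fin_simple_graph V E \<longleftrightarrow> finite V \<and> (\<forall>e\<in>E. e \<subseteq> V \<and> card e = 2)"

definition nbhd :: "'a set set \<Rightarrow> 'a \<Rightarrow> 'a set" where
  "nbhd E v = {w. {v, w} \<in> E}"

definition graph_complex :: "'a set \<Rightarrow> 'a set set \<Rightarrow> 'a set set" where
  "graph_complex V E = {{}} \<union> {{v} | v. v \<in> V} \<union> E"

definition simplicial_join :: "'a set set \<Rightarrow> 'b set set \<Rightarrow> ('a + 'b) set set" where
  "simplicial_join K L = {\<sigma> <+> \<tau> | \<sigma> \<tau>. \<sigma> \<in> K \<and> \<tau> \<in> L}"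

text \<open>
  The variables \<open>x\<^sub>1, \<dots>, x\<^sub>n\<close> are \<open>Inl 0, \<dots>, Inl (n - 1)\<close>, of degree 4; the variable belonging
  to a vertex \<open>y\<close> of the graph is \<open>Inr y\<close>, of degree 8.
\<close>

definition B_ring ::
    "nat \<Rightarrow> 'a set \<Rightarrow> 'a set set \<Rightarrow> ((nat + 'a \<Rightarrow>\<^sub>0 nat) \<Rightarrow>\<^sub>0 int) set graded_ring" where
  "B_ring n V E =
    SR ({..<n} <+> V) (simplicial_join (Pow {..<n}) (graph_complex V E))
      (case_sum (\<lambda>_. 4) (\<lambda>_. 8))"


section \<open>Algebras over the Steenrod algebra\<close>

text \<open>
  Unstable algebra structures over the mod \<open>p\<close> Steenrod algebra, \<open>p\<close> an odd prime, on a graded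
  commutative \<open>\<int>/p\<close>-algebra \<open>R\<close> concentrated in even degrees, so that the Bockstein acts as zero
  and only the reduced powers \<open>P a\<close> are recorded. The family of homogeneous maps
  \<open>R\<^sup>d \<rightarrow> R\<^sup>d\<^sup>+\<^sup>2\<^sup>a\<^sup>(\<^sup>p\<^sup>-\<^sup>1\<^sup>)\<close> is presented as one additive map on the whole of \<open>R\<close>; additive maps are
  \<open>\<int>/p\<close>-linear. In the Adem relation \<open>p * j \<le> a < p * b\<close> gives \<open>j < b\<close>, so the
  subtractions do not truncate.
\<close>

locale Steenrod_structure =
  fixes p :: nat and R :: "'a graded_ring" (structure) and P :: "nat \<Rightarrow> 'a \<Rightarrow> 'a"
  assumes P_closed: "x \<in> carrier R \<Longrightarrow> P a x \<in> carrier R"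
    and P_add: "x \<in> carrier R \<Longrightarrow> y \<in> carrier R \<Longrightarrow> P a (x \<oplus> y) = P a x \<oplus> P a y"
    and P_grade: "x \<in> grade R d \<Longrightarrow> P a x \<in> grade R (d + 2 * a * (p - 1))"
    and P_0: "x \<in> carrier R \<Longrightarrow> P 0 x = x"
    and Adem: "x \<in> carrier R \<Longrightarrow> a < p * b \<Longrightarrow>
      P a (P b x) = (\<Oplus>j\<in>{..a div p}.
        [((- 1) ^ (a + j) * int (((p - 1) * (b - j) - 1) choose (a - p * j)))] \<cdot>\<^bsub>R\<^esub>
          P (a + b - j) (P j x))"
    and Cartan: "x \<in> carrier R \<Longrightarrow> y \<in> carrier R \<Longrightarrow>
      P a (x \<otimes> y) = (\<Oplus>i\<in>{..a}. P i x \<otimes> P (a - i) y)"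
    and P_top: "x \<in> grade R (2 * a) \<Longrightarrow> P a x = x [^] p"
    and P_unstable: "x \<in> grade R d \<Longrightarrow> d < 2 * a \<Longrightarrow> P a x = \<zero>"


section \<open>Span colorings\<close>

definition span_coloring ::
    "nat \<Rightarrow> 'a set \<Rightarrow> 'a set set \<Rightarrow> ('a \<Rightarrow> 'k::field vec) \<Rightarrow> bool" where
  "span_coloring n V E f \<longleftrightarrow>
    (\<forall>v\<in>V. f v \<in> carrier_vec n - {0\<^sub>v n} \<and>
       f v \<notin> LinearCombinations.module.span class_ring (module_vec TYPE('k) n) (f ` nbhd E v))"

definition span_chromatic_number :: "'k::field itself \<Rightarrow> 'a set \<Rightarrow> 'a set set \<Rightarrow> nat" where
  "span_chromatic_number _ V E = (LEAST n. \<exists>f :: 'a \<Rightarrow> 'k vec. span_coloring n V E f)"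

text \<open>The minimum is attained: distinct unit vectors give a coloring.\<close>

lemma ex_span_coloring:
  assumes "fin_simple_graph V E"
  shows "\<exists>n. \<exists>f :: 'a \<Rightarrow> 'k::field vec. span_coloring n V E f"
proof -
  define n where "n = card V"
  interpret vec_space "TYPE('k)" n .
  have "finite V" using assms by (simp add: fin_simple_graph_def)
  then obtain h where h: "bij_betw h V {0..<n}"
    using ex_bij_betw_finite_nat n_def by blast
  define f :: "'a \<Rightarrow> 'k vec" where "f v = unit_vec n (h v)" for v
  have hn: "h v < n" if "v \<in> V" for v
    using bij_betwE[OF h] that by auto
  have "f v \<in> carrier_vec n - {0\<^sub>v n} \<and> f v \<notin> span (f ` nbhd E v)" if v: "v \<in> V" for v
  proof
    show "f v \<in> carrier_vec n - {0\<^sub>v n}"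
      using hn[OF v] by (simp add: f_def unit_vec_nonzero)
    have N: "w \<in> V \<and> h w \<noteq> h v" if "w \<in> nbhd E v" for w
    proof -
      have *: "{v, w} \<subseteq> V" "card {v, w} = 2"
        using that assms by (auto simp: nbhd_def fin_simple_graph_def)
      then have "v \<noteq> w" by auto
      then show ?thesis using * v bij_betw_imp_inj_on[OF h] by (auto dest: inj_onD)
    qed
    have zero: "u $ h v = 0" if hu: "u \<in> span (f ` nbhd E v)" for u
    proof -
      obtain a A where u: "u = lincomb a A" and A: "finite A" "A \<subseteq> f ` nbhd E v"
        using hu unfolding span_def by auto
      have "x $ h v = 0 \<and> x \<in> carrier_vec n" if "x \<in> A" for x
        using that A N hn v by (fastforce simp: f_def)
      then show ?thesis
        unfolding u by (subst lincomb_index) (auto simp: hn v intro!: sum.neutral)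
    qed
    show "f v \<notin> span (f ` nbhd E v)"
    proof
      assume "f v \<in> span (f ` nbhd E v)"
      from zero[OF this] show False using hn[OF v] by (simp add: f_def)
    qed
  qed
  then show ?thesis unfolding span_coloring_def by blast
qed


section \<open>The rings above are commutative rings\<close>

lemma cring_graded_poly_ring: "cring (graded_poly_ring V \<phi>)"
proof -
  have sub: "Poly_Mapping.keys t \<subseteq> V"
    if "t \<in> Poly_Mapping.keys (f * g)"
      "\<forall>t\<in>Poly_Mapping.keys f. Poly_Mapping.keys t \<subseteq> V"
      "\<forall>t\<in>Poly_Mapping.keys g. Poly_Mapping.keys t \<subseteq> V"
    for t and f g :: "('a \<Rightarrow>\<^sub>0 nat) \<Rightarrow>\<^sub>0 int"
  proof -
    from that(1) keys_mult[of f g] obtain a b where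
      "t = a + b" "a \<in> Poly_Mapping.keys f" "b \<in> Poly_Mapping.keys g" by blast
    then show ?thesis using that(2,3) Poly_Mapping.keys_add[of a b] by blast
  qed
  show ?thesis
  proof (rule cringI)
    show "abelian_group (graded_poly_ring V \<phi>)"
    proof (rule abelian_groupI)
      fix x assume "x \<in> carrier (graded_poly_ring V \<phi>)"
      then show "\<exists>y\<in>carrier (graded_poly_ring V \<phi>).
          y \<oplus>\<^bsub>graded_poly_ring V \<phi>\<^esub> x = \<zero>\<^bsub>graded_poly_ring V \<phi>\<^esub>"
        by (intro bexI[of _ "- x"]) (auto simp: graded_poly_ring_def)
    qed (use Poly_Mapping.keys_add in \<open>fastforce simp: graded_poly_ring_def algebra_simps\<close>)+
    show "comm_monoid (graded_poly_ring V \<phi>)"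
      by (rule comm_monoidI) (auto simp: graded_poly_ring_def algebra_simps dest: sub)
  qed (simp add: graded_poly_ring_def algebra_simps)
qed

lemma cring_graded_quot:
  assumes "cring R" and I: "ideal I R"
  shows "cring (graded_quot R I)"
proof -
  interpret Q: cring "R Quot I"
    using ideal.quotient_is_cring[OF I] assms(1) by simp
  have sel: "carrier (graded_quot R I) = carrier (R Quot I)"
    "monoid.mult (graded_quot R I) = monoid.mult (R Quot I)"
    "one (graded_quot R I) = one (R Quot I)" "zero (graded_quot R I) = zero (R Quot I)"
    "add (graded_quot R I) = add (R Quot I)"
    by (simp_all add: graded_quot_def ring.extend_def)
  show ?thesis
  proof (rule cringI)
    show "abelian_group (graded_quot R I)"
      by (rule abelian_groupI; simp add: sel Q.a_ac)
    show "comm_monoid (graded_quot R I)"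
      by (rule comm_monoidI; simp add: sel Q.m_ac)
  qed (simp add: sel Q.l_distr)
qed

lemma ideal_SR_ideal: "ideal (SR_ideal V K \<phi>) (graded_poly_ring V \<phi>)"
proof -
  interpret A: cring "graded_poly_ring V \<phi>" by (rule cring_graded_poly_ring)
  have var: "poly_var v \<in> carrier (graded_poly_ring V \<phi>)" if "v \<in> V" for v
    using that by (auto simp: poly_var_def graded_poly_ring_def)
  have "(\<Prod>v\<in>\<sigma>. poly_var v) \<in> carrier (graded_poly_ring V \<phi>)" if "\<sigma> \<subseteq> V" for \<sigma>
    using that
  proof (induction \<sigma> rule: infinite_finite_induct)
    case (insert v \<sigma>)
    then have "poly_var v \<otimes>\<^bsub>graded_poly_ring V \<phi>\<^esub> (\<Prod>w\<in>\<sigma>. poly_var w)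
        \<in> carrier (graded_poly_ring V \<phi>)"
      using var by (intro A.m_closed) auto
    with insert show ?case by (simp add: graded_poly_ring_def)
  qed (use A.one_closed in \<open>auto simp: graded_poly_ring_def\<close>)
  then show ?thesis unfolding SR_ideal_def by (intro A.genideal_ideal) auto
qed

lemma cring_SR: "cring (SR V K \<phi>)"
  unfolding SR_def by (intro cring_graded_quot cring_graded_poly_ring ideal_SR_ideal)

lemma cring_tensor_Zmod:
  assumes "cring R"
  shows "cring (tensor_Zmod R p)"
proof -
  interpret cring R by fact
  show ?thesis unfolding tensor_Zmod_def
    by (intro cring_graded_quot genideal_ideal assms) simp
qed

end

(* Idea. A point (xi, eta) over F_3 with eta supported on a face of G gives an evaluation of
   B(n,G) (x) Z/3, and composing it with P^1, which is a derivation, gives a point derivation.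
   Let f(v) in F_3^n collect the coefficients of y_v in P^1 x_1, ..., P^1 x_n.

   Since y_v^3 = P^1 P^3 y_v and P^3 y_v has degree 20, hence lies in the ideal (x_1, ..., x_n),
   the vectors f(v), f(w) are linearly independent whenever vw is an edge: at the point xi = 0,
   eta = (r, s) with r f(v) + s f(w) = 0 the derivation kills all x_i.

   The relations y_u y_w = 0 for non-edges and y_u y_w y_s = 0 for triangles force
   P^1 y_v = y_v L_v, up to terms involving leaves and, when G is a star, a cubic in x. If M is the
   polarized quadratic part of P^1 x, then P^1 P^1 x_i = -x_i^3 makes f(v), for every v that is not
   a leaf, a common eigenvector: M(xi, f(v)) = -L_v(xi) f(v). As M is symmetric, comparing
   M(f(u), f(v)) and M(f(v), f(u)) for an edge uv between such vertices gives L_v(f(u)) = 0, while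
   L_v(f(v)) is nonzero. So L_v separates f(v) from the span of its neighbors that are not leaves,
   and it remains to recolor the leaves. *)

theory Submission
  imports Defs
begin

section \<open>Span colorings from linear functionals\<close>

definition dot :: "nat \<Rightarrow> (nat \<Rightarrow> 'k::field) \<Rightarrow> (nat \<Rightarrow> 'k) \<Rightarrow> 'k" where
  "dot n c g = (\<Sum>i<n. c i * g i)"

lemma dot_linear_right:
  "dot n c (\<lambda>i. r * g i + s * h i) = r * dot n c g + s * dot n c h"
  by (simp add: dot_def sum_distrib_left sum.distrib algebra_simps)

text \<open>A functional that vanishes on the neighbor colors vanishes on their span, so a nonzero
  value at \<open>f v\<close> both keeps \<open>f v\<close> out of the span and makes it
  nonzero.\<close>

lemma span_coloring_of_functionals:
  fixes f :: "'a \<Rightarrow> nat \<Rightarrow> 'k::field"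
  assumes functional: "\<And>v. v \<in> V \<Longrightarrow>
    \<exists>c. dot n c (f v) \<noteq> 0 \<and> (\<forall>u\<in>nbhd E v. dot n c (f u) = 0)"
  shows "span_coloring n V E (\<lambda>v. vec n (f v))"
  unfolding span_coloring_def
proof
  interpret vec_space "TYPE('k)" n .
  fix v assume "v \<in> V"
  then obtain c where c: "dot n c (f v) \<noteq> 0" "\<And>u. u \<in> nbhd E v \<Longrightarrow> dot n c (f u) = 0"
    using functional by blast
  let ?S = "(\<lambda>v. vec n (f v)) ` nbhd E v"
  have dot: "vec n c \<bullet> vec n (f u) = dot n c (f u)" for u
    by (simp add: scalar_prod_def dot_def atLeast0LessThan)
  have "vec n c \<in> orthogonal_complement ?S"
    using c(2) dot by (auto simp: orthogonal_complement_def)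
  then have perp: "vec n c \<in> orthogonal_complement (span ?S)"
    by (subst in_orthogonal_complement_span) auto
  have "vec n (f v) \<notin> span ?S"
    using perp c(1) dot[of v] by (auto simp: orthogonal_complement_def)
  moreover have "vec n (f v) \<noteq> 0\<^sub>v n"
    using c(1) dot[of v] by auto
  ultimately show "vec n (f v) \<in> carrier_vec n - {0\<^sub>v n} \<and> vec n (f v) \<notin> span ?S"
    by auto
qed

text \<open>Independent \<open>g\<close> and \<open>h\<close> have a nonzero 2 by 2 minor; with
  \<open>g\<close> fixed, that minor is a functional of the other column, and it kills
  \<open>g\<close>.\<close>

lemma separating_functional:
  fixes g h :: "nat \<Rightarrow> 'k::field"
  assumes indep: "\<And>r s. (\<And>i. i < n \<Longrightarrow> r * g i + s * h i = 0) \<Longrightarrow> r = 0 \<and> s = 0"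
  shows "\<exists>c. dot n c g = 0 \<and> dot n c h \<noteq> 0"
proof -
  obtain i where i: "i < n" "g i \<noteq> 0"
    using indep[of 1 0] by auto
  \<comment> \<open>If every minor through row \<open>i\<close> vanished, \<open>- h i\<close> and
    \<open>g i\<close> would be the coefficients of a relation, although \<open>g i\<close> is
    nonzero.\<close>
  obtain j where j: "j < n" "h j * g i - h i * g j \<noteq> 0"
    using indep[of "- h i" "g i"] i(2) by (auto simp: algebra_simps)
  define c where "c k = (if k = j then g i else 0) - (if k = i then g j else 0)" for k
  have dot: "dot n c x = g i * x j - g j * x i" for x
    using i(1) j(1)
    by (simp add: dot_def c_def left_diff_distrib sum_subtractf if_distrib[of "\<lambda>z. z * _"] cong: if_cong)
  have "dot n c g = 0" "dot n c h \<noteq> 0"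
    unfolding dot using j(2) by (simp_all add: mult.commute)
  then show ?thesis by blast
qed

definition leaf :: "'a set set \<Rightarrow> 'a \<Rightarrow> bool" where
  "leaf E v \<longleftrightarrow> (\<exists>w. nbhd E v = {w})"

lemma nbhd_sym: "w \<in> nbhd E v \<longleftrightarrow> v \<in> nbhd E w"
  by (simp add: nbhd_def insert_commute)

text \<open>A leaf is recolored by moving its color along that of its neighbor \<open>w\<close> into the kernel of
  the functional belonging to \<open>w\<close>.\<close>

lemma ex_span_coloring_recolor_leaves:
  fixes f :: "'a \<Rightarrow> nat \<Rightarrow> 'k::field"
  assumes nbhd_sub: "\<And>v. nbhd E v \<subseteq> V"
    and indep: "\<And>v w r s. {v, w} \<in> E \<Longrightarrow> (\<And>i. i < n \<Longrightarrow> r * f v i + s * f w i = 0) \<Longrightarrow>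
      r = 0 \<and> s = 0"
    and functional: "\<And>v. v \<in> V \<Longrightarrow> \<not> leaf E v \<Longrightarrow>
      \<exists>c. dot n c (f v) \<noteq> 0 \<and> (\<forall>u\<in>nbhd E v. \<not> leaf E u \<longrightarrow> dot n c (f u) = 0)"
  shows "\<exists>g :: 'a \<Rightarrow> 'k vec. span_coloring n V E g"
proof -
  obtain c where c: "\<And>v. v \<in> V \<Longrightarrow> \<not> leaf E v \<Longrightarrow> dot n (c v) (f v) \<noteq> 0"
      "\<And>v u. v \<in> V \<Longrightarrow> \<not> leaf E v \<Longrightarrow> u \<in> nbhd E v \<Longrightarrow> \<not> leaf E u \<Longrightarrow> dot n (c v) (f u) = 0"
    using functional by metis
  define nb where "nb v = (THE w. nbhd E v = {w})" for v
  define q where "q v w = dot n (c w) (f v) / dot n (c w) (f w)" for v w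
  \<comment> \<open>Two leaves joined to each other form an isolated edge and keep their colors;
    independence along that edge suffices for them.\<close>
  define g where "g v = (if leaf E v \<and> \<not> leaf E (nb v)
    then (\<lambda>i. 1 * f v i + (- q v (nb v)) * f (nb v) i) else f v)" for v
  have nb: "nb v = w" if "nbhd E v = {w}" for v w
    using that by (simp add: nb_def)
  have "span_coloring n V E (\<lambda>v. vec n (g v))"
  proof (rule span_coloring_of_functionals)
    fix v assume v: "v \<in> V"
    show "\<exists>c. dot n c (g v) \<noteq> 0 \<and> (\<forall>u\<in>nbhd E v. dot n c (g u) = 0)"
    proof (cases "leaf E v")
      case False
      have "dot n (c v) (g u) = 0" if u: "u \<in> nbhd E v" for u
      proof (cases "leaf E u")
        case True
        with u have "nb u = v"
          using nbhd_sym[of v E u] by (auto simp: leaf_def nb)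
        then show ?thesis
          using True False c(1)[OF v] by (simp only: g_def dot_linear_right simp_thms if_True) (simp add: q_def)
      qed (use u c(2) v False in \<open>simp add: g_def\<close>)
      then show ?thesis
        using c(1)[OF v False] False by (intro exI[of _ "c v"]) (simp add: g_def)
    next
      case True
      then obtain w where w: "nbhd E v = {w}"
        by (auto simp: leaf_def)
      then have vw: "{v, w} \<in> E"
        by (auto simp: nbhd_def)
      \<comment> \<open>The neighbor of a leaf keeps its color: either it is no leaf, or it is one
        whose own neighbor is the leaf \<open>v\<close>.\<close>
      have gw: "g w = f w"
      proof (cases "leaf E w")
        case True
        moreover have "v \<in> nbhd E w"
          using w nbhd_sym[of w E v] by simp
        ultimately have "nb w = v" by (auto simp: leaf_def nb)
        then show ?thesis using \<open>leaf E v\<close> by (simp add: g_def)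
      qed (simp add: g_def)
      \<comment> \<open>Since \<open>g v\<close> differs from \<open>f v\<close> by a multiple of
        \<open>f w\<close>, the two colors stay independent, and \<open>w\<close> is the only
        neighbor to avoid.\<close>
      obtain t where t: "\<And>i. g v i = f v i + t * f w i"
      proof (cases "leaf E w")
        case True
        then have "g v i = f v i + 0 * f w i" for i by (simp add: g_def nb[OF w])
        then show ?thesis using that by blast
      next
        case False
        then have "g v i = f v i + (- q v w) * f w i" for i
          using \<open>leaf E v\<close> by (simp add: g_def nb[OF w])
        then show ?thesis using that by blast
      qed
      have gwv: "r = 0 \<and> s = 0" if rs: "\<And>i. i < n \<Longrightarrow> r * g w i + s * g v i = 0" for r s
      proof -
        have "s * f v i + (r + s * t) * f w i = 0" if "i < n" for i
          using rs[OF that] by (simp add: gw t algebra_simps)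
        from indep[OF vw this] show ?thesis by auto
      qed
      from separating_functional[of n "g w" "g v", OF this] show ?thesis
        by (auto simp: w)
    qed
  qed
  then show ?thesis by blast
qed

section \<open>Colorings from the values of \<open>P\<^sup>1\<close> at points\<close>

text \<open>The zero set of the Stanley-Reisner ideal of the graph: each \<open>T\<close> that is no
  face contains a vertex where \<open>\<eta>\<close> is zero.\<close>

definition face_point :: "'a set \<Rightarrow> 'a set set \<Rightarrow> ('a \<Rightarrow> 'k::zero) \<Rightarrow> bool" where
  "face_point V E \<eta> \<longleftrightarrow> (\<forall>T\<subseteq>V. (\<forall>v\<in>T. \<eta> v \<noteq> 0) \<longrightarrow> T \<in> graph_complex V E)"

abbreviation edge_point :: "'a \<Rightarrow> 'k::zero \<Rightarrow> 'a \<Rightarrow> 'k \<Rightarrow> 'a \<Rightarrow> 'k" where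
  "edge_point v r w s \<equiv> (\<lambda>u. 0)(v := r, w := s)"

lemma face_point_edge:
  assumes "{v, w} \<in> E" "v \<in> V" "w \<in> V"
  shows "face_point V E (edge_point v r w s)"
  unfolding face_point_def
proof (intro allI impI)
  fix T assume "T \<subseteq> V" "\<forall>u\<in>T. edge_point v r w s u \<noteq> 0"
  then have "T \<subseteq> {v, w}" by (auto split: if_splits)
  then have "T \<in> {{}, {v}, {w}, {v, w}}" by blast
  then show "T \<in> graph_complex V E"
    using assms by (auto simp: graph_complex_def)
qed

lemma face_point_vertex: "face_point V E ((\<lambda>u. 0)(v := r))"
  unfolding face_point_def
proof (intro allI impI)
  fix T assume "T \<subseteq> V" "\<forall>u\<in>T. ((\<lambda>u. 0)(v := r)) u \<noteq> 0"
  then have "T \<subseteq> V \<inter> {v}" by (auto split: if_splits)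
  then have "T = {} \<or> T = {v} \<and> v \<in> V" by blast
  then show "T \<in> graph_complex V E"
    by (auto simp: graph_complex_def)
qed

lemma face_point_0: "face_point V E (\<lambda>u. 0)"
  using face_point_vertex[of V E undefined 0] by (simp add: fun_upd_idem)

text \<open>Values at the point \<open>(\<xi>, \<eta>)\<close>: \<open>X \<xi> \<eta> i\<close> is the value of \<open>P\<^sup>1 x\<^sub>i\<close> and \<open>Y \<xi> \<eta> u\<close> that of \<open>P\<^sup>1 y\<^sub>u\<close>;
  \<open>Q\<close> is the part of \<open>P\<^sup>1 x\<^sub>i\<close> that is quadratic in \<open>x\<close>, and \<open>M\<close> is its polarization.\<close>

locale point_forms =
  fixes V :: "'a set" and n :: nat
    and a :: "'a \<Rightarrow> nat \<Rightarrow> 'k::field"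
    and b :: "nat \<Rightarrow> nat \<Rightarrow> nat \<Rightarrow> 'k"
    and \<gamma> :: "'a \<Rightarrow> 'a \<Rightarrow> nat \<Rightarrow> 'k"
    and C :: "'a \<Rightarrow> (nat \<Rightarrow> 'k) \<Rightarrow> 'k"
begin

definition Q :: "(nat \<Rightarrow> 'k) \<Rightarrow> nat \<Rightarrow> 'k" where
  "Q \<xi> i = (\<Sum>j<n. \<Sum>k<n. b i j k * (\<xi> j * \<xi> k))"

definition M :: "(nat \<Rightarrow> 'k) \<Rightarrow> (nat \<Rightarrow> 'k) \<Rightarrow> nat \<Rightarrow> 'k" where
  "M \<xi> \<zeta> i = (\<Sum>j<n. \<Sum>k<n. b i j k * (\<xi> j * \<zeta> k + \<zeta> j * \<xi> k))"

definition X :: "(nat \<Rightarrow> 'k) \<Rightarrow> ('a \<Rightarrow> 'k) \<Rightarrow> nat \<Rightarrow> 'k" where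
  "X \<xi> \<eta> i = (\<Sum>u\<in>V. a u i * \<eta> u) + Q \<xi> i"

definition Y :: "(nat \<Rightarrow> 'k) \<Rightarrow> ('a \<Rightarrow> 'k) \<Rightarrow> 'a \<Rightarrow> 'k" where
  "Y \<xi> \<eta> u = (\<Sum>s\<in>V. \<eta> s * dot n (\<gamma> u s) \<xi>) + C u \<xi>"

end

text \<open>What is kept of the Steenrod operations at points. \<open>nonedge\<close> and
  \<open>triangle\<close> are P^1 of the relations among the y; \<open>square\<close> is P^1 P^1 x_i
  = -x_i^3, the derivative of \<open>Q\<close> in direction \<open>X\<close> being given by
  \<open>M\<close>; \<open>indep\<close> and \<open>nonzero\<close> come from P^1 P^3 y.
  \<open>C u\<close> collects the part of P^1 y_u that is free of y.\<close>

locale steenrod_points = point_forms V n a b \<gamma> C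
  for V :: "'a set" and n and a :: "'a \<Rightarrow> nat \<Rightarrow> 'k::field" and b \<gamma> C +
  fixes E :: "'a set set"
  assumes graph: "fin_simple_graph V E"
    and two: "(2 :: 'k) \<noteq> 0"
    and nonedge: "u \<in> V \<Longrightarrow> w \<in> V \<Longrightarrow> u \<noteq> w \<Longrightarrow> {u, w} \<notin> E \<Longrightarrow> face_point V E \<eta> \<Longrightarrow>
      \<eta> u * Y \<xi> \<eta> w + \<eta> w * Y \<xi> \<eta> u = 0"
    and triangle: "u \<noteq> w \<Longrightarrow> u \<noteq> s \<Longrightarrow> w \<noteq> s \<Longrightarrow> u \<in> V \<Longrightarrow> w \<in> V \<Longrightarrow> s \<in> V \<Longrightarrow> face_point V E \<eta> \<Longrightarrow>
      \<eta> u * (\<eta> w * Y \<xi> \<eta> s + \<eta> s * Y \<xi> \<eta> w) + \<eta> w * \<eta> s * Y \<xi> \<eta> u = 0"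
    and square: "i < n \<Longrightarrow> face_point V E \<eta> \<Longrightarrow>
      (\<Sum>u\<in>V. a u i * Y \<xi> \<eta> u) + M (X \<xi> \<eta>) \<xi> i = - (\<xi> i ^ 3)"
    and indep: "{v, w} \<in> E \<Longrightarrow> (\<And>j. j < n \<Longrightarrow> r * a v j + t * a w j = 0) \<Longrightarrow> r = 0 \<and> t = 0"
    and nonzero: "v \<in> V \<Longrightarrow> \<exists>i<n. a v i \<noteq> 0"
begin

section \<open>Forms and sums at points supported on a vertex or an edge\<close>

lemma fin: "finite V"
  using graph by (simp add: fin_simple_graph_def)

lemma edgeD: "{v, w} \<in> E \<Longrightarrow> v \<in> V \<and> w \<in> V \<and> v \<noteq> w"
  using graph by (fastforce simp: fin_simple_graph_def)

lemma nbhdD: "w \<in> nbhd E v \<Longrightarrow> {v, w} \<in> E \<and> v \<in> V \<and> w \<in> V \<and> v \<noteq> w"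
  using edgeD by (auto simp: nbhd_def)

lemma M_commute: "M \<xi> \<zeta> i = M \<zeta> \<xi> i"
  unfolding M_def by (simp add: add.commute)

lemma M_diag: "M \<xi> \<xi> i = 2 * Q \<xi> i"
  unfolding M_def Q_def by (simp add: sum_distrib_left mult.assoc) (simp add: algebra_simps)

lemma M_linear: "M (\<lambda>j. r * \<xi> j + \<xi>' j) \<zeta> i = r * M \<xi> \<zeta> i + M \<xi>' \<zeta> i"
  unfolding M_def by (simp add: sum_distrib_left sum.distrib algebra_simps)

lemma Y_0: "Y \<xi> (\<lambda>_. 0) u = C u \<xi>"
  by (simp add: Y_def)

lemma sum_vertex: "v \<in> V \<Longrightarrow> (\<Sum>s\<in>V. ((\<lambda>u. 0 :: 'k)(v := r)) s * h s) = r * h v"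
  using fin by (simp add: if_distrib[of "\<lambda>z. z * _"] sum.delta cong: if_cong)

lemma sum_edge:
  assumes "v \<in> V" "w \<in> V" "v \<noteq> w"
  shows "(\<Sum>s\<in>V. edge_point v (r :: 'k) w t s * h s) = r * h v + t * h w"
proof -
  have "edge_point v r w t s * h s = ((\<lambda>u. 0)(v := r)) s * h s + ((\<lambda>u. 0)(w := t)) s * h s" for s
    using assms(3) by simp
  then show ?thesis
    using assms by (simp only: sum.distrib sum_vertex)
qed

lemma Y_vertex: "v \<in> V \<Longrightarrow> Y \<xi> ((\<lambda>u. 0)(v := r)) u = r * dot n (\<gamma> u v) \<xi> + C u \<xi>"
  unfolding Y_def by (simp only: sum_vertex)

lemma Y_edge: "v \<in> V \<Longrightarrow> w \<in> V \<Longrightarrow> v \<noteq> w \<Longrightarrow>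
    Y \<xi> (edge_point v r w t) u = r * dot n (\<gamma> u v) \<xi> + t * dot n (\<gamma> u w) \<xi> + C u \<xi>"
  unfolding Y_def by (simp only: sum_edge not_False_eq_True)

section \<open>Coefficients of P^1 y_u killed by the relations\<close>

text \<open>At a point supported on \<open>w\<close> the relation reads
  \<open>r * (r * dot n (\<gamma> u w) \<xi> + C u \<xi>) = 0\<close>; the values 1 and -1 of
  \<open>r\<close> separate the two terms, as 2 is invertible.\<close>

lemma nonedge_vanish:
  assumes "u \<in> V" "w \<in> V" "u \<noteq> w" "{u, w} \<notin> E"
  shows "C u \<xi> = 0" "dot n (\<gamma> u w) \<xi> = 0"
proof -
  have *: "r * (r * dot n (\<gamma> u w) \<xi> + C u \<xi>) = 0" for r
    using nonedge[OF assms face_point_vertex[of V E w r]] assms by (simp add: Y_vertex)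
  have "2 * C u \<xi> = 0"
    using *[of 1] *[of "-1"] by (simp add: algebra_simps)
  then show "C u \<xi> = 0" using two by simp
  then show "dot n (\<gamma> u w) \<xi> = 0" using *[of 1] by simp
qed

text \<open>A triangle of the graph is not filled in, so its monomial is a relation. On the edge
  \<open>{w, s}\<close> only the term with \<open>Y \<xi> \<eta> u\<close> is left of it, and the
  signs of the two coordinates isolate the parts.\<close>

lemma triangle_vanish:
  assumes "{u, w} \<in> E" "{u, s} \<in> E" "{w, s} \<in> E"
  shows "C u \<xi> = 0" "dot n (\<gamma> u w) \<xi> = 0"
proof -
  have V: "u \<in> V" "w \<in> V" "s \<in> V" "u \<noteq> w" "u \<noteq> s" "w \<noteq> s"
    using edgeD assms by auto
  have *: "r * t * (r * dot n (\<gamma> u w) \<xi> + t * dot n (\<gamma> u s) \<xi> + C u \<xi>) = 0" for r t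
    using triangle[OF V(4-6,1-3) face_point_edge[OF assms(3) V(2,3), of r t]] V
    by (simp add: Y_edge)
  have "2 * C u \<xi> = 0"
    using *[of 1 1] *[of "-1" "-1"] by (simp add: algebra_simps)
  then show C: "C u \<xi> = 0" using two by simp
  have "2 * dot n (\<gamma> u w) \<xi> = 0"
    using *[of 1 1] *[of 1 "-1"] C by (simp add: algebra_simps)
  then show "dot n (\<gamma> u w) \<xi> = 0" using two by simp
qed

text \<open>Here leaves have to be excluded: if \<open>s\<close> is adjacent to \<open>u\<close>,
  the argument takes a second neighbor \<open>w\<close> of \<open>s\<close>, and
  \<open>{u, w}\<close> either completes a triangle or is a non-edge.\<close>

lemma off_diagonal_vanish:
  assumes "u \<in> V" "s \<in> V" "u \<noteq> s" "\<not> leaf E s"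
  shows "dot n (\<gamma> u s) \<xi> = 0"
proof (cases "{u, s} \<in> E")
  case True
  then have "u \<in> nbhd E s" by (simp add: nbhd_def insert_commute)
  with assms(4) obtain w where w: "w \<in> nbhd E s" "w \<noteq> u"
    unfolding leaf_def by blast
  then have sw: "{s, w} \<in> E" "w \<in> V" "s \<noteq> w"
    using nbhdD by auto
  show ?thesis
  proof (cases "{u, w} \<in> E")
    case True
    then show ?thesis using triangle_vanish(2)[of u s w] sw \<open>{u, s} \<in> E\<close> by blast
  next
    case False
    \<comment> \<open>On the edge \<open>{s, w}\<close> the coordinate at \<open>u\<close> is 0 and
      that at \<open>w\<close> is 1, so the relation for the non-edge \<open>{u, w}\<close> reduces
      to this.\<close>
    have "Y \<xi> (edge_point s 1 w 1) u = 0"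
      using nonedge[OF assms(1) sw(2) w(2)[symmetric] False face_point_edge[OF sw(1) assms(2) sw(2), of 1 1], of \<xi>]
        assms w by simp
    then show ?thesis
      using Y_edge[OF assms(2) sw(2,3), of \<xi> 1 1 u]
        nonedge_vanish[OF assms(1) sw(2) w(2)[symmetric] False] by simp
  qed
qed (use nonedge_vanish assms in blast)

section \<open>Common eigenvectors of the quadratic part\<close>

text \<open>\<open>square\<close> has the same right side at the point with coordinate 1 at
  \<open>s\<close> and at \<open>\<eta> = 0\<close>. In the difference the terms with
  \<open>C\<close> and \<open>Q\<close> cancel, which leaves the eigenvector equation.\<close>

lemma eigenvector:
  assumes s: "s \<in> V" "\<not> leaf E s" and i: "i < n"
  shows "M \<xi> (a s) i = - dot n (\<gamma> s s) \<xi> * a s i"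
proof -
  let ?d = "(\<lambda>u. 0)(s := 1::'k)"
  have X: "X \<xi> ?d = (\<lambda>j. 1 * a s j + Q \<xi> j)"
    using sum_vertex[OF s(1), of 1 "\<lambda>u. a u _"] unfolding X_def by (simp only: mult.commute)
  have X0: "X \<xi> (\<lambda>_. 0) = Q \<xi>"
    unfolding X_def by simp
  have "(\<Sum>u\<in>V. a u i * Y \<xi> ?d u) = (\<Sum>u\<in>V. a u i * dot n (\<gamma> u s) \<xi>) + (\<Sum>u\<in>V. a u i * C u \<xi>)"
    using s by (simp add: Y_vertex sum.distrib distrib_left del: fun_upd_apply)
  also have "(\<Sum>u\<in>V. a u i * dot n (\<gamma> u s) \<xi>) = (\<Sum>u\<in>V. if u = s then a s i * dot n (\<gamma> s s) \<xi> else 0)"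
    using off_diagonal_vanish s by (intro sum.cong) auto
  also have "\<dots> = a s i * dot n (\<gamma> s s) \<xi>"
    using s fin by simp
  finally have Y: "(\<Sum>u\<in>V. a u i * Y \<xi> ?d u) =
      a s i * dot n (\<gamma> s s) \<xi> + (\<Sum>u\<in>V. a u i * C u \<xi>)" .
  \<comment> \<open>The two brackets are the left sides of \<open>square\<close> at the two
    points.\<close>
  have "a s i * dot n (\<gamma> s s) \<xi> + M (a s) \<xi> i =
      ((\<Sum>u\<in>V. a u i * Y \<xi> ?d u) + (1 * M (a s) \<xi> i + M (Q \<xi>) \<xi> i)) -
      ((\<Sum>u\<in>V. a u i * C u \<xi>) + M (Q \<xi>) \<xi> i)"
    unfolding Y by simp
  also have "(\<Sum>u\<in>V. a u i * Y \<xi> ?d u) + (1 * M (a s) \<xi> i + M (Q \<xi>) \<xi> i) = - (\<xi> i ^ 3)"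
    using square[OF i face_point_vertex[of V E s 1], of \<xi>] unfolding X M_linear .
  also have "(\<Sum>u\<in>V. a u i * C u \<xi>) + M (Q \<xi>) \<xi> i = - (\<xi> i ^ 3)"
    using square[OF i face_point_0, of \<xi>] unfolding X0 Y_0 .
  finally have "a s i * dot n (\<gamma> s s) \<xi> + M (a s) \<xi> i = 0"
    by simp
  then show ?thesis
    by (simp add: M_commute[of \<xi>] add_eq_0_iff algebra_simps)
qed

text \<open>A non-neighbor of \<open>s\<close> or a triangle through \<open>s\<close> kills
  \<open>C s\<close>. The remaining graphs are stars with center \<open>s\<close>, which have no
  edge between two vertices that are not leaves.\<close>

lemma C_vanish:
  assumes vu: "{v, u} \<in> E" and "\<not> leaf E v" "\<not> leaf E u" and s: "s \<in> V"
  shows "C s \<xi> = 0"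
proof (cases "\<exists>w\<in>V. w \<noteq> s \<and> {s, w} \<notin> E")
  case True
  then show ?thesis using nonedge_vanish(1) s by blast
next
  case False
  have uv: "{u, v} \<in> E" using vu by (simp add: insert_commute)
  have other: "\<exists>w. {x, w} \<in> E \<and> w \<noteq> y" if "{x, y} \<in> E" "\<not> leaf E x" for x y
    using that unfolding leaf_def nbhd_def by blast
  have "\<exists>x y. {s, x} \<in> E \<and> {s, y} \<in> E \<and> {x, y} \<in> E"
  proof (cases "s = v \<or> s = u")
    case True
    then obtain t where t: "{s, t} \<in> E" "\<not> leaf E t"
      using vu uv assms by blast
    \<comment> \<open>\<open>t\<close> has a neighbor besides \<open>s\<close>; as \<open>s\<close>
      is adjacent to every other vertex, this closes a triangle.\<close>
    then obtain w where w: "{t, w} \<in> E" "w \<noteq> s"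
      using other[of t s] by (auto simp: insert_commute)
    then show ?thesis using False t edgeD by blast
  next
    case False
    then have "{s, v} \<in> E" "{s, u} \<in> E"
      using \<open>\<not> (\<exists>w\<in>V. w \<noteq> s \<and> {s, w} \<notin> E)\<close> edgeD[OF vu] by auto
    then show ?thesis using vu by blast
  qed
  then show ?thesis using triangle_vanish(1) by blast
qed

text \<open>Otherwise, at \<open>\<xi> = a v\<close> and \<open>\<eta> = 0\<close>, the eigenvector
  equation makes \<open>2 * Q\<close> and hence \<open>X\<close> vanish. As \<open>C\<close>
  vanishes too, \<open>square\<close> says that each \<open>a v i ^ 3\<close> is zero, against
  \<open>nonzero\<close>.\<close>

lemma eigenvalue_nonzero:
  assumes "{v, u} \<in> E" "\<not> leaf E v" "\<not> leaf E u"
  shows "dot n (\<gamma> v v) (a v) \<noteq> 0"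
proof
  assume 0: "dot n (\<gamma> v v) (a v) = 0"
  have v: "v \<in> V" using assms edgeD by blast
  have Q0: "Q (a v) j = 0" if "j < n" for j
    using eigenvector[OF v assms(2) that, of "a v"] 0 two by (simp add: M_diag)
  have "a v i = 0" if i: "i < n" for i
  proof -
    have X0: "X (a v) (\<lambda>_. 0) = Q (a v)"
      unfolding X_def by simp
    have "M (Q (a v)) (a v) i = 0"
      using Q0 unfolding M_def by (intro sum.neutral ballI) simp
    then show ?thesis
      using square[OF i face_point_0, of "a v"] C_vanish[OF assms] by (simp add: X0 Y_0)
  qed
  then show False using nonzero[OF v] by blast
qed

text \<open>By symmetry of \<open>M\<close>, the vector \<open>M (a v) (a u)\<close> is a multiple
  of \<open>a v\<close> as well as of \<open>a u\<close>; independence makes both multiples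
  zero.\<close>

lemma eigenvalue_neighbor:
  assumes vu: "{v, u} \<in> E" and "\<not> leaf E v" "\<not> leaf E u"
  shows "dot n (\<gamma> v v) (a u) = 0"
proof -
  have V: "v \<in> V" "u \<in> V" using vu edgeD by auto
  have "dot n (\<gamma> v v) (a u) * a v i + (- dot n (\<gamma> u u) (a v)) * a u i = 0" if "i < n" for i
    using eigenvector[OF V(1) assms(2) that, of "a u"] eigenvector[OF V(2) assms(3) that, of "a v"]
    by (simp add: M_commute[of "a v"])
  then show ?thesis using indep[OF vu] by blast
qed

lemma ex_coloring: "\<exists>g :: 'a \<Rightarrow> 'k vec. span_coloring n V E g"
proof (rule ex_span_coloring_recolor_leaves)
  fix v assume v: "v \<in> V" "\<not> leaf E v"
  show "\<exists>c. dot n c (a v) \<noteq> 0 \<and> (\<forall>u\<in>nbhd E v. \<not> leaf E u \<longrightarrow> dot n c (a u) = 0)"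
  proof (cases "\<exists>u\<in>nbhd E v. \<not> leaf E u")
    case True
    then show ?thesis
      using v eigenvalue_nonzero eigenvalue_neighbor by (auto simp: nbhd_def intro!: exI[of _ "\<gamma> v v"])
  next
    case False
    \<comment> \<open>There is no neighbor except leaves, so no condition on neighbors remains and
      any coordinate that is nonzero at \<open>a v\<close> serves.\<close>
    obtain i where i: "i < n" "a v i \<noteq> 0" using nonzero v by blast
    have "dot n (\<lambda>j. if j = i then 1 else 0) (a v) = a v i"
      using i by (simp add: dot_def if_distrib[of "\<lambda>z. z * _"] cong: if_cong)
    then show ?thesis using False i by (intro exI[of _ "\<lambda>j. if j = i then 1 else 0"]) auto
  qed
next
  show "nbhd E v \<subseteq> V" for v using nbhdD by blast
qed (rule indep)

end

section \<open>Evaluation and point derivations of integer polynomials\<close>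

definition mono_eval :: "('v \<Rightarrow> 'k::field) \<Rightarrow> ('v \<Rightarrow>\<^sub>0 nat) \<Rightarrow> 'k" where
  "mono_eval p t = (\<Prod>v\<in>Poly_Mapping.keys t. p v ^ Poly_Mapping.lookup t v)"

definition poly_eval :: "('v \<Rightarrow> 'k::field) \<Rightarrow> (('v \<Rightarrow>\<^sub>0 nat) \<Rightarrow>\<^sub>0 int) \<Rightarrow> 'k" where
  "poly_eval p f = (\<Sum>t\<in>Poly_Mapping.keys f. of_int (Poly_Mapping.lookup f t) * mono_eval p t)"

lemma mono_eval_superset:
  assumes "finite S" "Poly_Mapping.keys t \<subseteq> S"
  shows "mono_eval p t = (\<Prod>v\<in>S. p v ^ Poly_Mapping.lookup t v)"
  unfolding mono_eval_def using assms
  by (intro prod.mono_neutral_left) (auto simp: in_keys_iff)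

lemma mono_eval_add: "mono_eval p (s + t) = mono_eval p s * mono_eval p t"
proof -
  let ?S = "Poly_Mapping.keys s \<union> Poly_Mapping.keys t"
  have "Poly_Mapping.keys (s + t) \<subseteq> ?S" by (rule Poly_Mapping.keys_add)
  then show ?thesis
    by (simp add: mono_eval_superset[of ?S] lookup_add power_add prod.distrib)
qed

lemma mono_eval_0 [simp]: "mono_eval p 0 = 1"
  by (simp add: mono_eval_def)

lemma mono_eval_single [simp]: "mono_eval p (Poly_Mapping.single v k) = p v ^ k"
  by (cases "k = 0") (simp_all add: mono_eval_def)

lemma poly_eval_superset:
  assumes "finite S" "Poly_Mapping.keys f \<subseteq> S"
  shows "poly_eval p f = (\<Sum>t\<in>S. of_int (Poly_Mapping.lookup f t) * mono_eval p t)"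
  unfolding poly_eval_def using assms
  by (intro sum.mono_neutral_left) (auto simp: in_keys_iff)

lemma poly_eval_0 [simp]: "poly_eval p 0 = 0"
  by (simp add: poly_eval_def)

lemma poly_eval_add: "poly_eval p (f + g) = poly_eval p f + poly_eval p g"
proof -
  let ?S = "Poly_Mapping.keys f \<union> Poly_Mapping.keys g"
  have "Poly_Mapping.keys (f + g) \<subseteq> ?S" by (rule Poly_Mapping.keys_add)
  then show ?thesis
    by (simp add: poly_eval_superset[of ?S] lookup_add distrib_right sum.distrib)
qed

lemma poly_eval_single [simp]: "poly_eval p (Poly_Mapping.single t c) = of_int c * mono_eval p t"
  by (cases "c = 0") (simp_all add: poly_eval_def)

text \<open>The \<open>single\<close> case meets only exponents that occur in the given
  \<open>f\<close>, which makes homogeneity of \<open>f\<close> available there.\<close>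

lemma poly_monomial_induct [case_names zero add single]:
  fixes f :: "'b \<Rightarrow>\<^sub>0 'c::comm_monoid_add"
  assumes "P 0" and "\<And>f g. P f \<Longrightarrow> P g \<Longrightarrow> P (f + g)"
    and "\<And>t c. t \<in> Poly_Mapping.keys f \<Longrightarrow> P (Poly_Mapping.single t c)"
  shows "P f"
proof -
  have "f = (\<Sum>t\<in>Poly_Mapping.keys f. Poly_Mapping.single t (Poly_Mapping.lookup f t))"
    by (rule poly_mapping_eqI) (auto simp: lookup_sum lookup_single when_def in_keys_iff sum.delta)
  moreover have "P (\<Sum>t\<in>T. Poly_Mapping.single t (Poly_Mapping.lookup f t))"
    if "finite T" "T \<subseteq> Poly_Mapping.keys f" for T
    using that by (induction T) (use assms in auto)
  ultimately show ?thesis by (metis finite_keys order_refl)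
qed

lemma poly_eval_mult: "poly_eval p (f * g) = poly_eval p f * poly_eval p g"
proof (induction f rule: poly_monomial_induct)
  case (single s c)
  show ?case
    by (induction g rule: poly_monomial_induct)
      (simp_all add: mult_single mono_eval_add poly_eval_add distrib_left)
qed (simp_all add: poly_eval_add distrib_right)

lemma poly_eval_of_int [simp]: "poly_eval p (of_int c) = of_int c"
  by (simp flip: single_of_int)

lemma poly_eval_1 [simp]: "poly_eval p 1 = 1"
  using poly_eval_of_int[of p 1] by simp

lemma poly_eval_var [simp]: "poly_eval p (poly_var v) = p v"
  by (simp add: poly_var_def)

lemma poly_eval_sum: "poly_eval p (sum f S) = (\<Sum>i\<in>S. poly_eval p (f i))"
  by (induction S rule: infinite_finite_induct) (simp_all add: poly_eval_add)

lemma poly_eval_prod: "poly_eval p (prod f S) = (\<Prod>i\<in>S. poly_eval p (f i))"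
  by (induction S rule: infinite_finite_induct) (simp_all add: poly_eval_mult)

text \<open>The carrier of \<open>graded_poly_ring W \<phi>\<close>, which does not depend on the
  weights.\<close>

definition poly_on :: "'v set \<Rightarrow> (('v \<Rightarrow>\<^sub>0 nat) \<Rightarrow>\<^sub>0 int) set" where
  "poly_on W = {f. \<forall>t\<in>Poly_Mapping.keys f. Poly_Mapping.keys t \<subseteq> W}"

lemma poly_on_0 [simp]: "0 \<in> poly_on W"
  by (simp add: poly_on_def)

lemma poly_on_add [intro]: "f \<in> poly_on W \<Longrightarrow> g \<in> poly_on W \<Longrightarrow> f + g \<in> poly_on W"
  using Poly_Mapping.keys_add[of f g] by (auto simp: poly_on_def)

lemma poly_on_mult [intro]:
  assumes "f \<in> poly_on W" "g \<in> poly_on W" shows "f * g \<in> poly_on W"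
  unfolding poly_on_def
proof (intro CollectI ballI)
  fix t assume "t \<in> Poly_Mapping.keys (f * g)"
  then obtain a b where "t = a + b" "a \<in> Poly_Mapping.keys f" "b \<in> Poly_Mapping.keys g"
    using keys_mult[of f g] by blast
  then show "Poly_Mapping.keys t \<subseteq> W"
    using assms Poly_Mapping.keys_add[of a b] unfolding poly_on_def by blast
qed

lemma poly_on_single [simp]: "Poly_Mapping.keys t \<subseteq> W \<Longrightarrow> Poly_Mapping.single t c \<in> poly_on W"
  by (simp add: poly_on_def)

lemma poly_on_of_int [simp]: "of_int c \<in> poly_on W"
  by (simp flip: single_of_int)

lemma poly_on_1 [simp]: "1 \<in> poly_on W"
  using poly_on_of_int[of 1] by simp

lemma poly_on_of_nat [simp]: "of_nat m \<in> poly_on W"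
  using poly_on_of_int[of "int m"] by simp

lemma poly_on_var [simp]: "v \<in> W \<Longrightarrow> poly_var v \<in> poly_on W"
  by (simp add: poly_var_def)

lemma poly_on_sum [intro]: "(\<And>i. i \<in> S \<Longrightarrow> f i \<in> poly_on W) \<Longrightarrow> sum f S \<in> poly_on W"
  by (induction S rule: infinite_finite_induct) auto

text \<open>A derivation with values in \<open>'k\<close>, on which polynomials act by evaluation at
  \<open>p\<close>. P^1 followed by an evaluation will be one.\<close>

locale point_derivation =
  fixes W :: "'v set" and p :: "'v \<Rightarrow> 'k::field" and D :: "(('v \<Rightarrow>\<^sub>0 nat) \<Rightarrow>\<^sub>0 int) \<Rightarrow> 'k"
  assumes D_add: "f \<in> poly_on W \<Longrightarrow> g \<in> poly_on W \<Longrightarrow> D (f + g) = D f + D g"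
    and D_mult: "f \<in> poly_on W \<Longrightarrow> g \<in> poly_on W \<Longrightarrow>
      D (f * g) = poly_eval p f * D g + D f * poly_eval p g"
begin

lemma D_0 [simp]: "D 0 = 0"
  using D_add[of 0 0] by (metis add.right_neutral add_left_cancel poly_on_0)

lemma D_of_int [simp]: "D (of_int c) = 0"
proof -
  have 1: "D 1 = 0"
    using D_mult[of 1 1]
    by (metis add.right_neutral add_left_cancel mult_1 mult.right_neutral poly_eval_1 poly_on_1)
  have nat: "D (of_int (int m)) = 0" for m
  proof (induction m)
    case (Suc m)
    then show ?case
      using D_add[of 1 "of_nat m"] 1 by simp
  qed simp
  show ?thesis
  proof (cases "c \<ge> 0")
    case True
    then show ?thesis using nat[of "nat c"] by simp
  next
    case False
    then show ?thesis
      using nat[of "nat (- c)"] D_add[of "of_int c" "of_int (- c)"] poly_on_of_int[of "- c" W]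
      by simp
  qed
qed

lemma D_scale: "f \<in> poly_on W \<Longrightarrow> D (of_int c * f) = of_int c * D f"
  by (simp add: D_mult)

lemma D_sum: "(\<And>i. i \<in> S \<Longrightarrow> f i \<in> poly_on W) \<Longrightarrow> D (sum f S) = (\<Sum>i\<in>S. D (f i))"
  by (induction S rule: infinite_finite_induct) (simp_all add: D_add poly_on_sum)

end

section \<open>Homogeneous polynomials in the variables of \<open>B(n, G)\<close>\<close>

definition mono_degree :: "('v \<Rightarrow> nat) \<Rightarrow> ('v \<Rightarrow>\<^sub>0 nat) \<Rightarrow> nat" where
  "mono_degree \<phi> t = (\<Sum>v\<in>Poly_Mapping.keys t. Poly_Mapping.lookup t v * \<phi> v)"

lemma mono_degree_add: "mono_degree \<phi> (s + t) = mono_degree \<phi> s + mono_degree \<phi> t"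
proof -
  let ?S = "Poly_Mapping.keys s \<union> Poly_Mapping.keys t"
  have *: "mono_degree \<phi> r = (\<Sum>v\<in>?S. Poly_Mapping.lookup r v * \<phi> v)"
    if "Poly_Mapping.keys r \<subseteq> ?S" for r
    unfolding mono_degree_def using that by (intro sum.mono_neutral_left) (auto simp: in_keys_iff)
  show ?thesis
    using Poly_Mapping.keys_add[of s t]
    by (simp add: * lookup_add distrib_right sum.distrib)
qed

text \<open>Monomials of small degree are classified below by removing one variable at a time, which
  lowers the degree by 4 or 8.\<close>

lemma split_off_variable:
  assumes "v \<in> Poly_Mapping.keys t"
  obtains t' where "t = Poly_Mapping.single v 1 + t'" "Poly_Mapping.keys t' \<subseteq> Poly_Mapping.keys t"
    "mono_degree \<phi> t = \<phi> v + mono_degree \<phi> t'"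
proof
  let ?t' = "t - Poly_Mapping.single v 1"
  show t: "t = Poly_Mapping.single v 1 + ?t'"
    using assms by (intro poly_mapping_eqI) (auto simp: lookup_add lookup_minus lookup_single when_def in_keys_iff)
  show "Poly_Mapping.keys ?t' \<subseteq> Poly_Mapping.keys t"
    by (auto simp: in_keys_iff lookup_minus)
  show "mono_degree \<phi> t = \<phi> v + mono_degree \<phi> ?t'"
    by (subst t, subst mono_degree_add) (simp add: mono_degree_def)
qed

abbreviation B_degree :: "nat + 'a \<Rightarrow> nat" where
  "B_degree \<equiv> case_sum (\<lambda>_. 4) (\<lambda>_. 8)"

abbreviation B_vars :: "nat \<Rightarrow> 'a set \<Rightarrow> (nat + 'a) set" where
  "B_vars n V \<equiv> Sum_Type.Plus {..<n} V"

abbreviation B_poly :: "nat \<Rightarrow> 'a set \<Rightarrow> ((nat + 'a \<Rightarrow>\<^sub>0 nat) \<Rightarrow>\<^sub>0 int) graded_ring" where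
  "B_poly n V \<equiv> graded_poly_ring (B_vars n V) B_degree"

lemma grade_B_polyD:
  assumes "f \<in> grade (B_poly n V) d" "t \<in> Poly_Mapping.keys f"
  shows "Poly_Mapping.keys t \<subseteq> B_vars n V" "mono_degree B_degree t = d"
  using assms by (auto simp: graded_poly_ring_def mono_degree_def)

lemma mono_degree_0D:
  fixes t :: "nat + 'a \<Rightarrow>\<^sub>0 nat"
  assumes "mono_degree B_degree t = 0"
  shows "t = 0"
proof -
  have "Poly_Mapping.lookup t v * B_degree v = 0" if "v \<in> Poly_Mapping.keys t" for v
    using assms that by (simp add: mono_degree_def)
  moreover have "B_degree v \<noteq> 0" for v :: "nat + 'a"
    by (cases v) auto
  ultimately show ?thesis
    by (intro poly_mapping_eqI) (metis in_keys_iff lookup_zero mult_is_0)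
qed

lemma mono_degree_4D:
  assumes "mono_degree B_degree t = 4" "Poly_Mapping.keys t \<subseteq> B_vars n V"
  obtains j where "j < n" "t = Poly_Mapping.single (Inl j) 1"
proof -
  have "Poly_Mapping.keys t \<noteq> {}"
    using assms(1) by (auto simp: mono_degree_def)
  then obtain v where v: "v \<in> Poly_Mapping.keys t" by blast
  from split_off_variable[OF v, of B_degree] obtain t'
    where t': "t = Poly_Mapping.single v 1 + t'" "mono_degree B_degree t = B_degree v + mono_degree B_degree t'"
    by blast
  with assms(1) obtain j where j: "v = Inl j" by (cases v) auto
  with t'(2) assms(1) have "t' = 0" by (simp add: mono_degree_0D)
  then show ?thesis using that[of j] t' j v assms(2) by auto
qed

lemma mono_degree_8_cases:
  assumes "mono_degree B_degree t = 8" "Poly_Mapping.keys t \<subseteq> B_vars n V"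
  obtains u where "u \<in> V" "t = Poly_Mapping.single (Inr u) 1"
  | j k where "j < n" "k < n" "t = Poly_Mapping.single (Inl j) 1 + Poly_Mapping.single (Inl k) 1"
proof -
  have "Poly_Mapping.keys t \<noteq> {}"
    using assms(1) by (auto simp: mono_degree_def)
  then obtain v where v: "v \<in> Poly_Mapping.keys t" by blast
  from split_off_variable[OF v, of B_degree] obtain t'
    where t': "t = Poly_Mapping.single v 1 + t'" "mono_degree B_degree t = B_degree v + mono_degree B_degree t'"
      and "Poly_Mapping.keys t' \<subseteq> Poly_Mapping.keys t"
    by blast
  then have t'_vars: "Poly_Mapping.keys t' \<subseteq> B_vars n V"
    using assms(2) by simp
  show ?thesis
  proof (cases v)
    case (Inl j)
    then have "mono_degree B_degree t' = 4" using t'(2) assms(1) by simp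
    then obtain k where "k < n" "t' = Poly_Mapping.single (Inl k) 1"
      using mono_degree_4D t'_vars by blast
    then show ?thesis using that(2)[of j k] t' Inl v assms(2) by auto
  next
    case (Inr u)
    then have "t' = 0" using t'(2) assms(1) by (simp add: mono_degree_0D)
    then show ?thesis using that(1)[of u] t' Inr v assms(2) by auto
  qed
qed

lemma single_eq_of_int_mult: "Poly_Mapping.single t c = of_int c * Poly_Mapping.single t 1"
  by (simp add: mult_single flip: single_of_int)

lemma sum_Kronecker:
  fixes h :: "'b \<Rightarrow> 'c::comm_ring_1"
  assumes "finite S" "s \<in> S"
  shows "(\<Sum>i\<in>S. of_int (if i = s then c else 0) * h i) = of_int c * h s"
  using assms by (simp add: if_distrib[of of_int] if_distrib[of "\<lambda>z. z * _"] cong: if_cong)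

text \<open>An identity of integer polynomials and not only of values, since a derivation has to be
  applied to it. The coefficients \<open>b\<close> are not made symmetric; the polarization
  \<open>M\<close> is symmetric for every \<open>b\<close>.\<close>

lemma degree_8_form:
  assumes "finite V" "f \<in> grade (B_poly n V) 8"
  shows "\<exists>a b. f = (\<Sum>u\<in>V. of_int (a u) * poly_var (Inr u)) +
    (\<Sum>j<n. \<Sum>k<n. of_int (b j k) * (poly_var (Inl j) * poly_var (Inl k)))"
proof (induction f rule: poly_monomial_induct)
  case zero
  show ?case by (intro exI[of _ "\<lambda>_. 0"] exI[of _ "\<lambda>_ _. 0"]) simp
next
  case (add f g)
  then obtain a b a' b' where
    "f = (\<Sum>u\<in>V. of_int (a u) * poly_var (Inr u)) +
      (\<Sum>j<n. \<Sum>k<n. of_int (b j k) * (poly_var (Inl j) * poly_var (Inl k)))"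
    "g = (\<Sum>u\<in>V. of_int (a' u) * poly_var (Inr u)) +
      (\<Sum>j<n. \<Sum>k<n. of_int (b' j k) * (poly_var (Inl j) * poly_var (Inl k)))"
    by blast
  then show ?case
    by (intro exI[of _ "\<lambda>u. a u + a' u"] exI[of _ "\<lambda>j k. b j k + b' j k"])
      (simp add: distrib_right sum.distrib)
next
  case (single t c)
  from mono_degree_8_cases[OF grade_B_polyD(2,1)[OF assms(2) single]] show ?case
  proof cases
    case (1 u)
    then show ?thesis
      using sum_Kronecker[OF assms(1), of u c "\<lambda>u. poly_var (Inr u :: nat + 'a)"]
      by (intro exI[of _ "\<lambda>w. if w = u then c else 0"] exI[of _ "\<lambda>_ _. 0"])
        (simp add: poly_var_def single_eq_of_int_mult[of _ c])
  next
    case (2 j k)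
    have "(\<Sum>j'<n. \<Sum>k'<n. of_int (if j' = j then if k' = k then c else 0 else 0) *
        (poly_var (Inl j') * poly_var (Inl k' :: nat + 'a))) =
      (\<Sum>j'<n. if j' = j then \<Sum>k'<n. of_int (if k' = k then c else 0) *
        (poly_var (Inl j) * poly_var (Inl k')) else 0)"
      by (intro sum.cong) auto
    also have "\<dots> = of_int c * (poly_var (Inl j) * poly_var (Inl k))"
      using 2 by (simp add: sum_Kronecker)
    finally show ?thesis
      using 2 by (intro exI[of _ "\<lambda>_. 0"] exI[of _ "\<lambda>j' k'. if j' = j then if k' = k then c else 0 else 0"])
        (simp add: poly_var_def single_eq_of_int_mult[of _ c] mult_single)
  qed
qed

text \<open>As 12 < 16, a monomial contains at most one y, and then exactly one x beside it. The
  formula is about values only, so the cubics in x go into a function \<open>C\<close>.\<close>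

lemma degree_12_eval:
  assumes "finite V" "f \<in> grade (B_poly n V) 12"
  shows "\<exists>(\<gamma> :: 'a \<Rightarrow> nat \<Rightarrow> 'k::field) C. \<forall>\<xi> \<eta>.
    poly_eval (case_sum \<xi> \<eta>) f = (\<Sum>s\<in>V. \<eta> s * dot n (\<gamma> s) \<xi>) + C \<xi>"
proof (induction f rule: poly_monomial_induct)
  case zero
  show ?case by (intro exI[of _ "\<lambda>_ _. 0"] exI[of _ "\<lambda>_. 0"]) (simp add: dot_def)
next
  case (add f g)
  then obtain \<gamma> \<gamma>' :: "'a \<Rightarrow> nat \<Rightarrow> 'k" and C C' where
    "\<And>\<xi> \<eta>. poly_eval (case_sum \<xi> \<eta>) f = (\<Sum>s\<in>V. \<eta> s * dot n (\<gamma> s) \<xi>) + C \<xi>"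
    "\<And>\<xi> \<eta>. poly_eval (case_sum \<xi> \<eta>) g = (\<Sum>s\<in>V. \<eta> s * dot n (\<gamma>' s) \<xi>) + C' \<xi>"
    by blast
  then show ?case
    by (intro exI[of _ "\<lambda>s j. \<gamma> s j + \<gamma>' s j"] exI[of _ "\<lambda>\<xi>. C \<xi> + C' \<xi>"])
      (simp add: poly_eval_add dot_def algebra_simps sum.distrib)
next
  case (single t c)
  note t = grade_B_polyD[OF assms(2) single]
  show ?case
  proof (cases "\<exists>u. Inr u \<in> Poly_Mapping.keys t")
    case True
    then obtain u where u: "Inr u \<in> Poly_Mapping.keys t" by blast
    from split_off_variable[OF u, of B_degree] obtain t'
      where t': "t = Poly_Mapping.single (Inr u) 1 + t'" "Poly_Mapping.keys t' \<subseteq> Poly_Mapping.keys t"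
        "mono_degree B_degree t = B_degree (Inr u :: nat + 'a) + mono_degree B_degree t'"
      by blast
    then have t'_deg: "mono_degree B_degree t' = 4" and t'_vars: "Poly_Mapping.keys t' \<subseteq> B_vars n V"
      using t by auto
    from mono_degree_4D[OF t'_deg t'_vars] obtain j where j: "j < n" "t' = Poly_Mapping.single (Inl j) 1" .
    have "u \<in> V" using u t(1) by auto
    have "poly_eval (case_sum \<xi> \<eta>) (Poly_Mapping.single t c) =
        (\<Sum>s\<in>V. \<eta> s * dot n (\<lambda>i. if s = u \<and> i = j then of_int c else 0) \<xi>) + 0"
      for \<xi> :: "nat \<Rightarrow> 'k" and \<eta>
    proof -
      have "poly_eval (case_sum \<xi> \<eta>) (Poly_Mapping.single t c) =
          (\<Sum>s\<in>V. if s = u then \<eta> u * dot n (\<lambda>i. if i = j then of_int c else 0) \<xi> else 0)"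
        using assms(1) j \<open>u \<in> V\<close>
        by (simp add: t'(1) mono_eval_add dot_def if_distrib[of "\<lambda>z. z * _"] cong: if_cong)
      also have "\<dots> = (\<Sum>s\<in>V. \<eta> s * dot n (\<lambda>i. if s = u \<and> i = j then of_int c else 0) \<xi>) + 0"
        by (auto intro!: sum.cong simp: dot_def)
      finally show ?thesis .
    qed
    then show ?thesis
      by (intro exI[of _ "\<lambda>s i. if s = u \<and> i = j then of_int c else 0"] exI[of _ "\<lambda>_. 0"]) blast
  next
    case False
    \<comment> \<open>Without y in the monomial its value is independent of \<open>\<eta>\<close>,
      which may be set to zero to obtain a contribution to \<open>C\<close>.\<close>
    have "mono_eval (case_sum \<xi> \<eta>) t = mono_eval (case_sum \<xi> (\<lambda>_. 0)) t" for \<xi> :: "nat \<Rightarrow> 'k" and \<eta>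
      unfolding mono_eval_def using False by (intro prod.cong) (auto split: sum.split)
    then show ?thesis
      by (intro exI[of _ "\<lambda>_ _. 0"] exI[of _ "\<lambda>\<xi>. of_int c * mono_eval (case_sum \<xi> (\<lambda>_. 0)) t"])
        (simp add: dot_def)
  qed
qed

text \<open>Since \<open>8\<close> does not divide \<open>20\<close>, every monomial of degree \<open>20\<close> contains some \<open>x\<^sub>j\<close>.\<close>

lemma D_degree_20:
  assumes "point_derivation (B_vars n V) p D" and f: "f \<in> grade (B_poly n V) 20"
    and x: "\<And>j. j < n \<Longrightarrow> p (Inl j) = 0" "\<And>j. j < n \<Longrightarrow> D (poly_var (Inl j)) = 0"
  shows "D f = 0"
proof -
  interpret point_derivation "B_vars n V" p D by fact
  \<comment> \<open>Membership in \<open>poly_on\<close> is carried through the induction because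
    \<open>D\<close> is additive only there.\<close>
  have "f \<in> poly_on (B_vars n V) \<and> D f = 0"
  proof (induction f rule: poly_monomial_induct)
    case (add f g)
    then show ?case by (auto simp: D_add)
  next
    case (single t c)
    note t = grade_B_polyD[OF f single]
    have "\<exists>j. Inl j \<in> Poly_Mapping.keys t"
    proof (rule ccontr)
      assume "\<nexists>j. Inl j \<in> Poly_Mapping.keys t"
      then have "8 dvd mono_degree B_degree t"
        unfolding mono_degree_def by (intro dvd_sum) (auto split: sum.split)
      then show False using t(2) by simp
    qed
    then obtain j where j: "Inl j \<in> Poly_Mapping.keys t" by blast
    from split_off_variable[OF j] obtain t'
      where t': "t = Poly_Mapping.single (Inl j) 1 + t'" "Poly_Mapping.keys t' \<subseteq> Poly_Mapping.keys t"
      by blast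
    have "Poly_Mapping.single t c = poly_var (Inl j) * Poly_Mapping.single t' c"
      by (simp add: t'(1) poly_var_def mult_single)
    moreover have "j < n" using j t(1) by auto
    moreover have "poly_var (Inl j) \<in> poly_on (B_vars n V)"
      "Poly_Mapping.single t' c \<in> poly_on (B_vars n V)"
      using \<open>j < n\<close> t'(2) t(1) by (auto intro!: poly_on_var)
    \<comment> \<open>Leibniz: the factor x_j has both value and derivative zero.\<close>
    ultimately show ?case
      using x by (auto simp: D_mult)
  qed simp
  then show ?thesis ..
qed

section \<open>From derivations at points to the forms \<open>X\<close> and \<open>Y\<close>\<close>

text \<open>\<open>D \<xi> \<eta>\<close> stands for P^1 followed by evaluation at
  \<open>(\<xi>, \<eta>)\<close>. In each hypothesis one polynomial \<open>g\<close> serves all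
  points, as it represents P^1 x_i, P^1 y_u or P^3 y_u; the -5 is the coefficient in P^1 P^3 = -5
  P^4.\<close>

lemma coloring_of_derivations:
  fixes V :: "'a set" and D :: "(nat \<Rightarrow> 'k::field) \<Rightarrow> ('a \<Rightarrow> 'k) \<Rightarrow> ((nat + 'a \<Rightarrow>\<^sub>0 nat) \<Rightarrow>\<^sub>0 int) \<Rightarrow> 'k"
  assumes graph: "fin_simple_graph V E" and three: "(3 :: 'k) = 0"
    and deriv: "\<And>\<xi> \<eta>. face_point V E \<eta> \<Longrightarrow> point_derivation (B_vars n V) (case_sum \<xi> \<eta>) (D \<xi> \<eta>)"
    and P1x: "\<And>i. i < n \<Longrightarrow> \<exists>g\<in>grade (B_poly n V) 8. \<forall>\<xi> \<eta>. face_point V E \<eta> \<longrightarrow>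
      D \<xi> \<eta> (poly_var (Inl i)) = poly_eval (case_sum \<xi> \<eta>) g \<and> D \<xi> \<eta> g = - (\<xi> i ^ 3)"
    and P1y: "\<And>u. u \<in> V \<Longrightarrow> \<exists>g\<in>grade (B_poly n V) 12. \<forall>\<xi> \<eta>. face_point V E \<eta> \<longrightarrow>
      D \<xi> \<eta> (poly_var (Inr u)) = poly_eval (case_sum \<xi> \<eta>) g"
    and P3y: "\<And>u. u \<in> V \<Longrightarrow> \<exists>g\<in>grade (B_poly n V) 20. \<forall>\<xi> \<eta>. face_point V E \<eta> \<longrightarrow>
      D \<xi> \<eta> g = - 5 * \<eta> u ^ 3"
    and nonface: "\<And>\<sigma> \<xi> \<eta>. \<sigma> \<subseteq> V \<Longrightarrow> \<sigma> \<notin> graph_complex V E \<Longrightarrow> face_point V E \<eta> \<Longrightarrow>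
      D \<xi> \<eta> (\<Prod>u\<in>\<sigma>. poly_var (Inr u)) = 0"
  shows "\<exists>g :: 'a \<Rightarrow> 'k vec. span_coloring n V E g"
proof -
  have finV: "finite V" using graph by (simp add: fin_simple_graph_def)
  have edge: "v \<in> V \<and> w \<in> V \<and> v \<noteq> w" if "{v, w} \<in> E" for v w
    using graph that by (fastforce simp: fin_simple_graph_def)
  have two: "(2 :: 'k) \<noteq> 0"
  proof
    assume "(2 :: 'k) = 0"
    then have "(3 :: 'k) = 1" by (metis add.left_neutral numeral_plus_one semiring_norm(5))
    then show False using three by simp
  qed
  have five: "(5 :: 'k) \<noteq> 0"
  proof
    assume "(5 :: 'k) = 0"
    moreover have "(5 :: 'k) = 3 + 2" by simp
    ultimately show False using three two by simp
  qed
  have var: "poly_var (Inl i) \<in> poly_on (B_vars n V)" if "i < n" for i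
    using that by (auto intro!: poly_on_var)
  have var': "poly_var (Inr u) \<in> poly_on (B_vars n V)" if "u \<in> V" for u
    using that by (auto intro!: poly_on_var)

  \<comment> \<open>The coefficients of P^1 x_i have to be the same at all points, so the property
    quantifies over the points and is named before coefficients are chosen for every
    \<open>i\<close>.\<close>
  define is_form where "is_form i a b \<longleftrightarrow> (\<forall>\<xi> \<eta>. face_point V E \<eta> \<longrightarrow>
      D \<xi> \<eta> (poly_var (Inl i)) = (\<Sum>u\<in>V. of_int (a u) * \<eta> u) +
        (\<Sum>j<n. \<Sum>k<n. of_int (b j k) * (\<xi> j * \<xi> k)) \<and>
      (\<Sum>u\<in>V. of_int (a u) * D \<xi> \<eta> (poly_var (Inr u))) +
        (\<Sum>j<n. \<Sum>k<n. of_int (b j k) *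
          (D \<xi> \<eta> (poly_var (Inl j)) * \<xi> k + \<xi> j * D \<xi> \<eta> (poly_var (Inl k)))) = - (\<xi> i ^ 3))"
    for i and a :: "'a \<Rightarrow> int" and b :: "nat \<Rightarrow> nat \<Rightarrow> int"
  have "\<exists>a b. is_form i a b" if i: "i < n" for i
  proof -
    obtain g where g: "g \<in> grade (B_poly n V) 8"
      "\<And>\<xi> \<eta>. face_point V E \<eta> \<Longrightarrow> D \<xi> \<eta> (poly_var (Inl i)) = poly_eval (case_sum \<xi> \<eta>) g \<and>
        D \<xi> \<eta> g = - (\<xi> i ^ 3)"
      using P1x[OF i] by blast
    obtain a b where ab: "g = (\<Sum>u\<in>V. of_int (a u) * poly_var (Inr u)) +
        (\<Sum>j<n. \<Sum>k<n. of_int (b j k) * (poly_var (Inl j) * poly_var (Inl k)))"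
      using degree_8_form[OF finV g(1)] by blast
    \<comment> \<open>Leibniz applied to the form of P^1 x_i; with the known value of
      \<open>D \<xi> \<eta> g\<close> this becomes \<open>square\<close>.\<close>
    have Dg: "(\<Sum>u\<in>V. of_int (a u) * D \<xi> \<eta> (poly_var (Inr u))) +
        (\<Sum>j<n. \<Sum>k<n. of_int (b j k) *
          (D \<xi> \<eta> (poly_var (Inl j)) * \<xi> k + \<xi> j * D \<xi> \<eta> (poly_var (Inl k)))) = D \<xi> \<eta> g"
      if "face_point V E \<eta>" for \<xi> \<eta>
    proof -
      interpret point_derivation "B_vars n V" "case_sum \<xi> \<eta>" "D \<xi> \<eta>"
        by (rule deriv[OF that])
      have "D \<xi> \<eta> g = D \<xi> \<eta> (\<Sum>u\<in>V. of_int (a u) * poly_var (Inr u)) +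
        D \<xi> \<eta> (\<Sum>j<n. \<Sum>k<n. of_int (b j k) * (poly_var (Inl j) * poly_var (Inl k)))"
        unfolding ab by (rule D_add) (intro poly_on_sum poly_on_mult poly_on_of_int var var'; simp)+
      also have "D \<xi> \<eta> (\<Sum>u\<in>V. of_int (a u) * poly_var (Inr u)) =
          (\<Sum>u\<in>V. of_int (a u) * D \<xi> \<eta> (poly_var (Inr u)))"
        using var' by (subst D_sum) (auto intro!: sum.cong D_scale)
      also have "D \<xi> \<eta> (\<Sum>j<n. \<Sum>k<n. of_int (b j k) * (poly_var (Inl j) * poly_var (Inl k))) =
          (\<Sum>j<n. D \<xi> \<eta> (\<Sum>k<n. of_int (b j k) * (poly_var (Inl j) * poly_var (Inl k))))"
        by (rule D_sum) (intro poly_on_sum poly_on_mult poly_on_of_int var; simp)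
      also have "\<dots> = (\<Sum>j<n. \<Sum>k<n. D \<xi> \<eta> (of_int (b j k) * (poly_var (Inl j) * poly_var (Inl k))))"
        by (intro sum.cong refl D_sum) (intro poly_on_mult poly_on_of_int var; simp)
      also have "\<dots> = (\<Sum>j<n. \<Sum>k<n. of_int (b j k) *
          (D \<xi> \<eta> (poly_var (Inl j)) * \<xi> k + \<xi> j * D \<xi> \<eta> (poly_var (Inl k))))"
        using var by (intro sum.cong refl) (simp add: D_scale poly_on_mult D_mult add.commute)
      finally show ?thesis by simp
    qed
    have eval_g: "poly_eval (case_sum \<xi> \<eta>) g = (\<Sum>u\<in>V. of_int (a u) * \<eta> u) +
        (\<Sum>j<n. \<Sum>k<n. of_int (b j k) * (\<xi> j * \<xi> k))" for \<xi> \<eta> :: "_ \<Rightarrow> 'k"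
      unfolding ab by (simp add: poly_eval_add poly_eval_sum poly_eval_mult)
    show ?thesis unfolding is_form_def
      by (intro exI[of _ a] exI[of _ b] allI impI) (simp only: Dg eval_g g(2) simp_thms)
  qed
  then obtain a b where "\<And>i. i < n \<Longrightarrow> is_form i (a i) (b i)"
    by metis
  then have
    Dx: "\<And>i \<xi> \<eta>. i < n \<Longrightarrow> face_point V E \<eta> \<Longrightarrow> D \<xi> \<eta> (poly_var (Inl i)) =
      (\<Sum>u\<in>V. of_int (a i u) * \<eta> u) + (\<Sum>j<n. \<Sum>k<n. of_int (b i j k) * (\<xi> j * \<xi> k))"
    and DDx: "\<And>i \<xi> \<eta>. i < n \<Longrightarrow> face_point V E \<eta> \<Longrightarrow>
      (\<Sum>u\<in>V. of_int (a i u) * D \<xi> \<eta> (poly_var (Inr u))) +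
        (\<Sum>j<n. \<Sum>k<n. of_int (b i j k) *
          (D \<xi> \<eta> (poly_var (Inl j)) * \<xi> k + \<xi> j * D \<xi> \<eta> (poly_var (Inl k)))) = - (\<xi> i ^ 3)"
    unfolding is_form_def by blast+

  define is_y_form where "is_y_form u \<gamma> C \<longleftrightarrow> (\<forall>\<xi> \<eta>. face_point V E \<eta> \<longrightarrow>
      D \<xi> \<eta> (poly_var (Inr u)) = (\<Sum>s\<in>V. \<eta> s * dot n (\<gamma> s) \<xi>) + C \<xi>)"
    for u and \<gamma> :: "'a \<Rightarrow> nat \<Rightarrow> 'k" and C
  have "\<exists>\<gamma> C. is_y_form u \<gamma> C" if "u \<in> V" for u
  proof -
    obtain g where g: "g \<in> grade (B_poly n V) 12" "\<And>\<xi> \<eta>. face_point V E \<eta> \<Longrightarrow>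
        D \<xi> \<eta> (poly_var (Inr u)) = poly_eval (case_sum \<xi> \<eta>) g"
      using P1y[OF \<open>u \<in> V\<close>] by blast
    obtain \<gamma> :: "'a \<Rightarrow> nat \<Rightarrow> 'k" and C where
      "\<forall>\<xi> \<eta>. poly_eval (case_sum \<xi> \<eta>) g = (\<Sum>s\<in>V. \<eta> s * dot n (\<gamma> s) \<xi>) + C \<xi>"
      using degree_12_eval[OF finV g(1)] by blast
    then show ?thesis
      unfolding is_y_form_def using g(2) by (intro exI[of _ \<gamma>] exI[of _ C]) simp
  qed
  then obtain \<gamma> C where "\<And>u. u \<in> V \<Longrightarrow> is_y_form u (\<gamma> u) (C u)"
    by metis
  then have Dy: "\<And>u \<xi> \<eta>. u \<in> V \<Longrightarrow> face_point V E \<eta> \<Longrightarrow>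
      D \<xi> \<eta> (poly_var (Inr u)) = (\<Sum>s\<in>V. \<eta> s * dot n (\<gamma> u s) \<xi>) + C u \<xi>"
    unfolding is_y_form_def by blast

  interpret F: point_forms V n "\<lambda>u i. of_int (a i u)" "\<lambda>i j k. of_int (b i j k)" \<gamma> C .
  have X: "D \<xi> \<eta> (poly_var (Inl i)) = F.X \<xi> \<eta> i" if "i < n" "face_point V E \<eta>" for \<xi> \<eta> i
    using Dx[OF that] by (simp add: F.X_def F.Q_def)
  have Y: "D \<xi> \<eta> (poly_var (Inr u)) = F.Y \<xi> \<eta> u" if "u \<in> V" "face_point V E \<eta>" for \<xi> \<eta> u
    using Dy[OF that] by (simp add: F.Y_def)

  \<comment> \<open>At \<open>\<xi> = 0\<close> the quadratic part is gone, so the hypothesis says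
    that \<open>D\<close> kills every x_i. Then it kills P^3 y_u, of degree 20, while its value
    there is \<open>- 5 * \<eta> u ^ 3\<close>.\<close>
  have cube: "\<eta> u = 0"
    if \<eta>: "face_point V E \<eta>" "\<And>i. i < n \<Longrightarrow> (\<Sum>u\<in>V. of_int (a i u) * \<eta> u) = 0" "u \<in> V" for \<eta> :: "'a \<Rightarrow> 'k" and u
  proof -
    obtain g where g: "g \<in> grade (B_poly n V) 20" "D (\<lambda>_. 0) \<eta> g = - 5 * \<eta> u ^ 3"
      using P3y \<eta>(1,3) by blast
    have "D (\<lambda>_. 0) \<eta> g = 0"
      by (rule D_degree_20[OF deriv[OF \<eta>(1)] g(1)]) (simp_all add: Dx \<eta>)
    then show ?thesis using g(2) five by simp
  qed

  interpret steenrod_points V n "\<lambda>u i. of_int (a i u)" "\<lambda>i j k. of_int (b i j k)" \<gamma> C E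
  proof
    fix u w and \<xi> :: "nat \<Rightarrow> 'k" and \<eta> :: "'a \<Rightarrow> 'k"
    assume *: "u \<in> V" "w \<in> V" "u \<noteq> w" "{u, w} \<notin> E" and \<eta>: "face_point V E \<eta>"
    interpret point_derivation "B_vars n V" "case_sum \<xi> \<eta>" "D \<xi> \<eta>"
      by (rule deriv[OF \<eta>])
    have "{u, w} \<notin> graph_complex V E"
      using * by (auto simp: graph_complex_def doubleton_eq_iff)
    from nonface[OF _ this \<eta>, of \<xi>] * have "D \<xi> \<eta> (poly_var (Inr u) * poly_var (Inr w)) = 0"
      by simp
    then show "\<eta> u * F.Y \<xi> \<eta> w + \<eta> w * F.Y \<xi> \<eta> u = 0"
      using * var' by (simp add: D_mult Y[OF _ \<eta>] mult.commute)
  next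
    fix u w s and \<xi> :: "nat \<Rightarrow> 'k" and \<eta> :: "'a \<Rightarrow> 'k"
    assume *: "u \<noteq> w" "u \<noteq> s" "w \<noteq> s" "u \<in> V" "w \<in> V" "s \<in> V" and \<eta>: "face_point V E \<eta>"
    interpret point_derivation "B_vars n V" "case_sum \<xi> \<eta>" "D \<xi> \<eta>"
      by (rule deriv[OF \<eta>])
    have "card {u, w, s} = 3" using * by simp
    then have "{u, w, s} \<notin> E"
      using graph by (auto simp: fin_simple_graph_def)
    then have "{u, w, s} \<notin> graph_complex V E"
      using * by (auto simp: graph_complex_def)
    from nonface[OF _ this \<eta>, of \<xi>] *
    have "D \<xi> \<eta> (poly_var (Inr u) * (poly_var (Inr w) * poly_var (Inr s))) = 0"
      by simp
    then show "\<eta> u * (\<eta> w * F.Y \<xi> \<eta> s + \<eta> s * F.Y \<xi> \<eta> w) + \<eta> w * \<eta> s * F.Y \<xi> \<eta> u = 0"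
      using * var' by (simp add: D_mult poly_on_mult poly_eval_mult Y[OF _ \<eta>] algebra_simps)
  next
    fix i and \<xi> :: "nat \<Rightarrow> 'k" and \<eta> :: "'a \<Rightarrow> 'k"
    assume i: "i < n" and \<eta>: "face_point V E \<eta>"
    have "(\<Sum>u\<in>V. of_int (a i u) * F.Y \<xi> \<eta> u) =
        (\<Sum>u\<in>V. of_int (a i u) * D \<xi> \<eta> (poly_var (Inr u)))"
      by (intro sum.cong refl) (simp add: Y \<eta>)
    moreover have "F.M (F.X \<xi> \<eta>) \<xi> i = (\<Sum>j<n. \<Sum>k<n. of_int (b i j k) *
          (D \<xi> \<eta> (poly_var (Inl j)) * \<xi> k + \<xi> j * D \<xi> \<eta> (poly_var (Inl k))))"
      unfolding F.M_def by (intro sum.cong refl) (simp add: X \<eta>)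
    ultimately show "(\<Sum>u\<in>V. of_int (a i u) * F.Y \<xi> \<eta> u) + F.M (F.X \<xi> \<eta>) \<xi> i = - (\<xi> i ^ 3)"
      using DDx[OF i \<eta>] by simp
  next
    fix v w and r t :: 'k
    assume vw: "{v, w} \<in> E" and 0: "\<And>i. i < n \<Longrightarrow> r * of_int (a i v) + t * of_int (a i w) = 0"
    note V = edge[OF vw]
    \<comment> \<open>A relation between the two color vectors is a point on the edge where all
      linear forms vanish; \<open>cube\<close> then makes its coordinates zero.\<close>
    have "(\<Sum>u\<in>V. of_int (a i u) * edge_point v r w t u) = 0" if "i < n" for i
    proof -
      have "(\<Sum>u\<in>V. of_int (a i u) * edge_point v r w t u) =
          (\<Sum>u\<in>V. (if u = v then r * of_int (a i v) else 0) + (if u = w then t * of_int (a i w) else 0))"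
        using V by (intro sum.cong) (auto simp: mult.commute)
      then show ?thesis using 0[OF that] V finV by (simp add: sum.distrib)
    qed
    from cube[OF face_point_edge[OF vw] this] V have "edge_point v r w t u = 0" if "u \<in> V" for u
      using that by blast
    from this[of v] this[of w] V show "r = 0 \<and> t = 0" by simp
  next
    fix v assume v: "v \<in> V"
    show "\<exists>i<n. (of_int (a i v) :: 'k) \<noteq> 0"
    proof (rule ccontr)
      assume neg: "\<not> (\<exists>i<n. (of_int (a i v) :: 'k) \<noteq> 0)"
      have 0: "(of_int (a i v) :: 'k) = 0" if "i < n" for i
        by (rule ccontr) (use neg that in simp)
      have "(\<Sum>u\<in>V. of_int (a i u) * ((\<lambda>_. 0)(v := 1::'k)) u) = 0" if "i < n" for i
        using 0[OF that] by (intro sum.neutral) auto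
      from cube[OF face_point_vertex this v] show False by simp
    qed
  qed (rule graph two)+
  show ?thesis by (rule ex_coloring)
qed

section \<open>Evaluation homomorphisms on the quotient\<close>

lemma graded_quot_sel:
  "carrier (graded_quot R I) = carrier (R Quot I)"
  "monoid.mult (graded_quot R I) = monoid.mult (R Quot I)"
  "one (graded_quot R I) = one (R Quot I)"
  "zero (graded_quot R I) = zero (R Quot I)"
  "add (graded_quot R I) = add (R Quot I)"
  by (simp_all add: graded_quot_def ring.extend_def)

lemma grade_graded_quot: "grade (graded_quot R I) d = (\<lambda>x. I +>\<^bsub>R\<^esub> x) ` grade R d"
  by (simp add: graded_quot_def ring.extend_def graded_ring.fields_def)

lemma carrier_graded_quot: "carrier (graded_quot R I) = (\<lambda>x. I +>\<^bsub>R\<^esub> x) ` carrier R"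
  unfolding graded_quot_sel by (auto simp: FactRing_def A_RCOSETS_def')

lemma graded_quot_hom:
  assumes "ideal I R"
  shows "(\<lambda>x. I +>\<^bsub>R\<^esub> x) \<in> Ring.ring_hom R (graded_quot R I)"
  using ideal.rcos_ring_hom[OF assms] unfolding Ring.ring_hom_def graded_quot_sel by simp

lemma quot_zero_of_mem:
  assumes "ideal I R" "x \<in> I"
  shows "I +>\<^bsub>R\<^esub> x = \<zero>\<^bsub>graded_quot R I\<^esub>"
proof -
  interpret ideal I R by fact
  show ?thesis
    using a_rcos_zero[OF assms] by (simp add: graded_quot_sel FactRing_def)
qed

text \<open>The kernel of \<open>h\<close> is an ideal that contains the generators.\<close>

lemma genideal_vanish:
  assumes "ring_hom_ring R S h" "G \<subseteq> carrier R" "\<And>g. g \<in> G \<Longrightarrow> h g = \<zero>\<^bsub>S\<^esub>"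
    and "x \<in> genideal R G"
  shows "h x = \<zero>\<^bsub>S\<^esub>"
proof -
  interpret ring_hom_ring R S h by fact
  have "genideal R G \<subseteq> a_kernel R S h"
    by (rule R.genideal_minimal[OF kernel_is_ideal]) (use assms(2,3) in \<open>unfold a_kernel_def', blast\<close>)
  then show ?thesis using assms(4) unfolding a_kernel_def' by blast
qed

lemma graded_quot_hom_lift:
  assumes "ring_hom_ring R S h" "ideal I R" and van: "\<And>x. x \<in> I \<Longrightarrow> h x = \<zero>\<^bsub>S\<^esub>"
  obtains h' where "h' \<in> Ring.ring_hom (graded_quot R I) S"
    "\<And>x. x \<in> carrier R \<Longrightarrow> h' (I +>\<^bsub>R\<^esub> x) = h x"
proof -
  interpret ring_hom_ring R S h by fact
  interpret ideal I R by fact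
  note \<pi> = graded_quot_hom[OF assms(2)]
  \<comment> \<open>\<open>h\<close> is constant on each coset, so its image there is a singleton,
    from which the value is read off.\<close>
  define h' where "h' X = the_elem (h ` X)" for X
  have h': "h' (I +>\<^bsub>R\<^esub> x) = h x" if x: "x \<in> carrier R" for x
  proof -
    have "h y = h x" if "y \<in> I +>\<^bsub>R\<^esub> x" for y
      using that x van by (auto simp: a_r_coset_def' a_Hcarr)
    moreover have "x \<in> I +>\<^bsub>R\<^esub> x"
      using a_rcos_self[OF x] .
    ultimately have "h ` (I +>\<^bsub>R\<^esub> x) = {h x}"
      by blast
    then show ?thesis by (simp add: h'_def)
  qed
  have "h' \<in> Ring.ring_hom (graded_quot R I) S"
  proof (rule ring_hom_memI)
    fix X assume "X \<in> carrier (graded_quot R I)"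
    then obtain x where x: "x \<in> carrier R" "X = I +>\<^bsub>R\<^esub> x" by (auto simp: carrier_graded_quot)
    then show "h' X \<in> carrier S" by (simp add: h')
    fix Y assume "Y \<in> carrier (graded_quot R I)"
    then obtain y where y: "y \<in> carrier R" "Y = I +>\<^bsub>R\<^esub> y" by (auto simp: carrier_graded_quot)
    show "h' (X \<otimes>\<^bsub>graded_quot R I\<^esub> Y) = h' X \<otimes>\<^bsub>S\<^esub> h' Y"
      using x y ring_hom_mult[OF \<pi> x(1) y(1)] by (simp add: h' flip: ring_hom_mult[OF \<pi>])
    show "h' (X \<oplus>\<^bsub>graded_quot R I\<^esub> Y) = h' X \<oplus>\<^bsub>S\<^esub> h' Y"
      using x y by (simp add: h' flip: ring_hom_add[OF \<pi>])
  next
    show "h' \<one>\<^bsub>graded_quot R I\<^esub> = \<one>\<^bsub>S\<^esub>"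
      using h'[of "\<one>\<^bsub>R\<^esub>"] ring_hom_one[OF \<pi>] by simp
  qed
  then show ?thesis using that h' by blast
qed

lemma class_ring_sel:
  "carrier class_ring = UNIV" "monoid.mult class_ring = (*)" "one class_ring = 1"
  "zero class_ring = 0" "add class_ring = (+)"
  by (simp_all add: class_ring_simps)

text \<open>Turns the integer coefficients of the Adem relations, which are multiples taken in
  \<open>R\<close>, into scalars of \<open>'k\<close>.\<close>

lemma class_ring_int_multiple:
  assumes "ring_hom_ring R (class_ring :: 'k::field ring) h" "x \<in> carrier R"
  shows "h ([(k :: int)] \<cdot>\<^bsub>R\<^esub> x) = of_int k * h x"
proof -
  have of_neg: "- of_nat (nat (- k)) = (of_int k :: 'k)" if "k < 0"
    using that by simp
  interpret ring_hom_ring R "class_ring :: 'k ring" h by fact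
  have nat: "h ([(m :: nat)] \<cdot>\<^bsub>R\<^esub> x) = of_nat m * h x" for m
  proof (induction m)
    case 0
    show ?case using hom_zero unfolding class_ring_sel by simp
  next
    case (Suc m)
    have "h ([m] \<cdot>\<^bsub>R\<^esub> x \<oplus>\<^bsub>R\<^esub> x) = h ([m] \<cdot>\<^bsub>R\<^esub> x) + h x"
      using hom_add[OF R.add.nat_pow_closed[OF assms(2)] assms(2)] unfolding class_ring_sel .
    then show ?case using Suc by (simp add: distrib_right add.commute)
  qed
  have neg: "h (\<ominus>\<^bsub>R\<^esub> y) = - h y" if "y \<in> carrier R" for y
  proof -
    have "h (\<ominus>\<^bsub>R\<^esub> y \<oplus>\<^bsub>R\<^esub> y) = h (\<ominus>\<^bsub>R\<^esub> y) + h y"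
      using hom_add[OF R.a_inv_closed[OF that] that] unfolding class_ring_sel .
    moreover have "h (\<ominus>\<^bsub>R\<^esub> y \<oplus>\<^bsub>R\<^esub> y) = 0"
      unfolding R.l_neg[OF that] hom_zero class_ring_sel ..
    ultimately show ?thesis
      by (simp only: eq_neg_iff_add_eq_0)
  qed
  show ?thesis
  proof (cases "k < 0")
    case True
    then have "[k] \<cdot>\<^bsub>R\<^esub> x = \<ominus>\<^bsub>R\<^esub> ([nat (- k)] \<cdot>\<^bsub>R\<^esub> x)"
      unfolding add_pow_def int_pow_def2 a_inv_def by (simp only: if_True)
    then show ?thesis
      using neg[OF R.add.nat_pow_closed[OF assms(2)]]
      by (simp only: nat mult_minus_left[symmetric] of_neg[OF True])
  next
    case False
    then have "[k] \<cdot>\<^bsub>R\<^esub> x = [nat k] \<cdot>\<^bsub>R\<^esub> x"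
      unfolding add_pow_def int_pow_def2 by (simp only: if_False)
    moreover have "of_nat (nat k) = (of_int k :: 'k)"
      using False by simp
    ultimately show ?thesis
      by (simp only: nat)
  qed
qed

section \<open>The projection of polynomials onto a Stanley-Reisner ring modulo p, and evaluations
  of the quotient\<close>

lemma carrier_graded_poly_ring: "carrier (graded_poly_ring W \<phi>) = poly_on W"
  by (simp add: graded_poly_ring_def poly_on_def)

lemma grade_graded_poly_ring_sub: "grade (graded_poly_ring W \<phi>) d \<subseteq> poly_on W"
  by (auto simp: graded_poly_ring_def poly_on_def)

lemma graded_poly_ring_sel:
  "monoid.mult (graded_poly_ring W \<phi>) = (*)" "add (graded_poly_ring W \<phi>) = (+)"
  "one (graded_poly_ring W \<phi>) = 1" "zero (graded_poly_ring W \<phi>) = 0"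
  by (simp_all add: graded_poly_ring_def)

lemma ring_class_ring: "ring (class_ring :: 'k::field ring)"
  using class_field unfolding field_def domain_def cring_def by blast

lemma poly_eval_hom: "ring_hom_ring (graded_poly_ring W \<phi>) (class_ring :: 'k::field ring) (poly_eval p)"
  by (rule ring_hom_ringI[OF cring.axioms(1)[OF cring_graded_poly_ring] ring_class_ring])
    (simp_all add: class_ring_sel graded_poly_ring_sel poly_eval_add poly_eval_mult)

lemma poly_on_prod: "(\<And>i. i \<in> S \<Longrightarrow> f i \<in> poly_on W) \<Longrightarrow> prod f S \<in> poly_on W"
  by (induction S rule: infinite_finite_induct) auto

text \<open>The composite projection, first modulo the Stanley-Reisner ideal and then modulo p; its
  values are cosets of cosets.\<close>

definition tensor_SR_class ::
    "'v set \<Rightarrow> 'v set set \<Rightarrow> ('v \<Rightarrow> nat) \<Rightarrow> nat \<Rightarrow> (('v \<Rightarrow>\<^sub>0 nat) \<Rightarrow>\<^sub>0 int) \<Rightarrow>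
     (('v \<Rightarrow>\<^sub>0 nat) \<Rightarrow>\<^sub>0 int) set set" where
  "tensor_SR_class W K \<phi> p f =
    genideal (SR W K \<phi>) {[p] \<cdot>\<^bsub>SR W K \<phi>\<^esub> \<one>\<^bsub>SR W K \<phi>\<^esub>} +>\<^bsub>SR W K \<phi>\<^esub>
      (SR_ideal W K \<phi> +>\<^bsub>graded_poly_ring W \<phi>\<^esub> f)"

lemma ideal_p:
  assumes "cring R"
  shows "ideal (genideal R {[(p::nat)] \<cdot>\<^bsub>R\<^esub> \<one>\<^bsub>R\<^esub>}) R"
proof -
  interpret cring R by fact
  show ?thesis by (intro genideal_ideal) simp
qed

context
  fixes W :: "'v set" and K :: "'v set set" and \<phi> :: "'v \<Rightarrow> nat" and p :: nat
begin

private abbreviation "A \<equiv> graded_poly_ring W \<phi>"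
private abbreviation "R \<equiv> tensor_Zmod (SR W K \<phi>) p"
private abbreviation "\<pi> \<equiv> tensor_SR_class W K \<phi> p"

text \<open>Homogeneous elements have homogeneous polynomial representatives; this turns the degree
  of P^a of a variable into information about a polynomial.\<close>

lemma grade_tensor_SR: "grade R d = \<pi> ` grade A d"
  unfolding tensor_Zmod_def grade_graded_quot
  by (subst (2) SR_def) (simp add: grade_graded_quot image_image tensor_SR_class_def)

lemma tensor_SR_class_hom: "\<pi> \<in> Ring.ring_hom A R"
proof -
  have "(\<lambda>f. SR_ideal W K \<phi> +>\<^bsub>A\<^esub> f) \<in> Ring.ring_hom A (SR W K \<phi>)"
    unfolding SR_def by (rule graded_quot_hom[OF ideal_SR_ideal])
  from ring_hom_trans[OF this graded_quot_hom[OF ideal_p[OF cring_SR]]]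
  show ?thesis
    unfolding tensor_Zmod_def by (simp add: tensor_SR_class_def[abs_def] comp_def)
qed

lemma tensor_SR_class_simps:
  assumes "f \<in> poly_on W" "g \<in> poly_on W"
  shows "\<pi> (f + g) = \<pi> f \<oplus>\<^bsub>R\<^esub> \<pi> g" "\<pi> (f * g) = \<pi> f \<otimes>\<^bsub>R\<^esub> \<pi> g" "\<pi> f \<in> carrier R"
  using ring_hom_add[OF tensor_SR_class_hom, of f g] ring_hom_mult[OF tensor_SR_class_hom, of f g]
    ring_hom_closed[OF tensor_SR_class_hom, of f] assms
  by (simp_all add: carrier_graded_poly_ring graded_poly_ring_sel)

lemma poly_var_prod_carrier: "\<sigma> \<subseteq> W \<Longrightarrow> (\<Prod>v\<in>\<sigma>. poly_var v) \<in> poly_on W"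
  by (intro poly_on_prod poly_on_var) auto

lemma tensor_SR_class_nonface:
  assumes "\<sigma> \<subseteq> W" "\<sigma> \<notin> K"
  shows "\<pi> (\<Prod>v\<in>\<sigma>. poly_var v) = \<zero>\<^bsub>R\<^esub>"
proof -
  interpret A: cring A by (rule cring_graded_poly_ring)
  have gens: "{\<Prod>v\<in>\<sigma>. poly_var v | \<sigma>. \<sigma> \<subseteq> W \<and> \<sigma> \<notin> K} \<subseteq> carrier A"
    unfolding carrier_graded_poly_ring using poly_var_prod_carrier by blast
  have "(\<Prod>v\<in>\<sigma>. poly_var v) \<in> SR_ideal W K \<phi>"
    unfolding SR_ideal_def using A.genideal_self[OF gens] assms by blast
  then have "SR_ideal W K \<phi> +>\<^bsub>A\<^esub> (\<Prod>v\<in>\<sigma>. poly_var v) = \<zero>\<^bsub>SR W K \<phi>\<^esub>"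
    unfolding SR_def by (rule quot_zero_of_mem[OF ideal_SR_ideal])
  then show ?thesis
    unfolding tensor_SR_class_def tensor_Zmod_def
    using quot_zero_of_mem[OF ideal_p[OF cring_SR]] additive_subgroup.zero_closed[OF ideal.axioms(1)[OF ideal_p[OF cring_SR]]]
    by metis
qed

text \<open>Evaluation at \<open>q\<close> descends through both quotients: it kills the monomials
  of nonfaces by the choice of \<open>q\<close>, and p by the characteristic of
  \<open>'k\<close>.\<close>

lemma tensor_SR_eval:
  fixes q :: "'v \<Rightarrow> 'k::field"
  assumes p: "(of_nat p :: 'k) = 0"
    and q: "\<And>\<sigma>. \<sigma> \<subseteq> W \<Longrightarrow> \<sigma> \<notin> K \<Longrightarrow> (\<Prod>v\<in>\<sigma>. q v) = 0"
  obtains \<epsilon> where "ring_hom_ring R (class_ring :: 'k ring) \<epsilon>"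
    "\<And>f. f \<in> poly_on W \<Longrightarrow> \<epsilon> (\<pi> f) = poly_eval q f"
proof -
  have gens: "{\<Prod>v\<in>\<sigma>. poly_var v | \<sigma>. \<sigma> \<subseteq> W \<and> \<sigma> \<notin> K} \<subseteq> carrier A"
    unfolding carrier_graded_poly_ring using poly_var_prod_carrier by blast
  have "poly_eval q f = 0" if "f \<in> SR_ideal W K \<phi>" for f
  proof -
    have "poly_eval q g = \<zero>\<^bsub>(class_ring :: 'k ring)\<^esub>"
      if "g \<in> {\<Prod>v\<in>\<sigma>. poly_var v | \<sigma>. \<sigma> \<subseteq> W \<and> \<sigma> \<notin> K}" for g
      using that q by (auto simp: class_ring_sel poly_eval_prod)
    from genideal_vanish[OF poly_eval_hom gens this that[unfolded SR_ideal_def]]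
    show ?thesis unfolding class_ring_sel .
  qed
  then obtain h where h: "h \<in> Ring.ring_hom (SR W K \<phi>) (class_ring :: 'k ring)"
      "\<And>f. f \<in> carrier A \<Longrightarrow> h (SR_ideal W K \<phi> +>\<^bsub>A\<^esub> f) = poly_eval q f"
    using graded_quot_hom_lift[OF poly_eval_hom ideal_SR_ideal, of W K \<phi> q]
    unfolding SR_def class_ring_sel by metis
  interpret S: cring "SR W K \<phi>" by (rule cring_SR)
  have hom: "ring_hom_ring (SR W K \<phi>) (class_ring :: 'k ring) h"
    by (rule ring_hom_ringI2[OF S.ring_axioms ring_class_ring h(1)])
  have "[p] \<cdot>\<^bsub>SR W K \<phi>\<^esub> \<one>\<^bsub>SR W K \<phi>\<^esub> = [int p] \<cdot>\<^bsub>SR W K \<phi>\<^esub> \<one>\<^bsub>SR W K \<phi>\<^esub>"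
    by (simp add: add_pow_def int_pow_def2)
  then have "h ([p] \<cdot>\<^bsub>SR W K \<phi>\<^esub> \<one>\<^bsub>SR W K \<phi>\<^esub>) = 0"
    using class_ring_int_multiple[OF hom S.one_closed, of "int p"] p by simp
  then have "h x = 0" if "x \<in> genideal (SR W K \<phi>) {[p] \<cdot>\<^bsub>SR W K \<phi>\<^esub> \<one>\<^bsub>SR W K \<phi>\<^esub>}" for x
    using genideal_vanish[OF hom _ _ that] by (simp add: class_ring_sel)
  then obtain \<epsilon> where \<epsilon>: "\<epsilon> \<in> Ring.ring_hom R (class_ring :: 'k ring)"
    "\<And>x. x \<in> carrier (SR W K \<phi>) \<Longrightarrow>
      \<epsilon> (genideal (SR W K \<phi>) {[p] \<cdot>\<^bsub>SR W K \<phi>\<^esub> \<one>\<^bsub>SR W K \<phi>\<^esub>} +>\<^bsub>SR W K \<phi>\<^esub> x) = h x"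
    using graded_quot_hom_lift[OF hom ideal_p[OF cring_SR], of p] 
    unfolding tensor_Zmod_def class_ring_sel by metis
  show ?thesis
  proof
    show "ring_hom_ring R (class_ring :: 'k ring) \<epsilon>"
      by (rule ring_hom_ringI2[OF cring.axioms(1)[OF cring_tensor_Zmod[OF cring_SR]] ring_class_ring \<epsilon>(1)])
    fix f assume f: "f \<in> poly_on W"
    then have "SR_ideal W K \<phi> +>\<^bsub>A\<^esub> f \<in> carrier (SR W K \<phi>)"
      unfolding SR_def carrier_graded_quot carrier_graded_poly_ring by blast
    then show "\<epsilon> (\<pi> f) = poly_eval q f"
      unfolding tensor_SR_class_def using \<epsilon>(2) h(2) f by (simp add: carrier_graded_poly_ring)
  qed
qed

end

section \<open>The operations \<open>P\<^sup>1\<close> and \<open>P\<^sup>3\<close> at points\<close>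

text \<open>If no factor vanished, the graph part of \<open>\<sigma>\<close> would lie in the
  support of \<open>\<eta>\<close> and be a face; the simplex part always is one, so
  \<open>\<xi>\<close> is unrestricted.\<close>

lemma case_sum_nonface_vanish:
  fixes \<eta> :: "'a \<Rightarrow> 'k::field"
  assumes "finite V" "face_point V E \<eta>" "\<sigma> \<subseteq> B_vars n V"
    "\<sigma> \<notin> simplicial_join (Pow {..<n}) (graph_complex V E)"
  shows "(\<Prod>v\<in>\<sigma>. case_sum \<xi> \<eta> v) = 0"
proof (rule ccontr)
  assume "\<not> ?thesis"
  moreover have "finite \<sigma>" using assms(1,3) by (meson finite_Plus finite_lessThan finite_subset)
  ultimately have nz: "case_sum \<xi> \<eta> v \<noteq> 0" if "v \<in> \<sigma>" for v
    using that by (auto simp: prod_zero_iff)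
  define T where "T = {u. Inr u \<in> \<sigma>}"
  have "T \<subseteq> V" using assms(3) by (auto simp: T_def)
  moreover have "\<forall>v\<in>T. \<eta> v \<noteq> 0" using nz by (force simp: T_def)
  ultimately have "T \<in> graph_complex V E"
    using assms(2) by (simp add: face_point_def)
  moreover have "\<sigma> = Sum_Type.Plus {j. Inl j \<in> \<sigma>} T"
    by (auto simp: T_def Plus_def image_iff) (metis sum.exhaust)
  moreover have "{j. Inl j \<in> \<sigma>} \<subseteq> {..<n}" using assms(3) by auto
  ultimately show False
    using assms(4) unfolding simplicial_join_def by blast
qed

context Steenrod_structure
begin

text \<open>The Cartan formula in its lowest case, with P^0 the identity: P^1 is a
  derivation.\<close>

lemma P_1_mult:
  assumes "cring R" "x \<in> carrier R" "y \<in> carrier R"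
  shows "P 1 (x \<otimes> y) = x \<otimes> P 1 y \<oplus> P 1 x \<otimes> y"
proof -
  interpret cring R by fact
  have "P 1 (x \<otimes> y) = (\<Oplus>i\<in>insert 1 {0}. P i x \<otimes> P (1 - i) y)"
    using Cartan[OF assms(2,3), of 1] by (simp add: atMost_Suc)
  also have "\<dots> = P 1 x \<otimes> P 0 y \<oplus> P 0 x \<otimes> P 1 y"
    using assms(2,3) by (subst finsum_insert) (auto simp: P_closed)
  also have "\<dots> = x \<otimes> P 1 y \<oplus> P 1 x \<otimes> y"
    using assms(2,3) by (simp add: P_0 P_closed a_comm)
  finally show ?thesis .
qed

lemma P_zero:
  assumes "cring R"
  shows "P a \<zero> = \<zero>"
proof -
  interpret cring R by fact
  have "P a \<zero> \<oplus> P a \<zero> = P a \<zero>"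
    using P_add[of \<zero> \<zero> a] by simp
  then show ?thesis
    using P_closed[of \<zero> a] by (metis add.l_cancel_one zero_closed)
qed

text \<open>For \<open>a = 1\<close> the Adem sum stops at \<open>j = 0\<close>, where the sign is
  -1 and the binomial coefficient is \<open>(p - 1) * b - 1\<close>.\<close>

lemma P_1_P:
  assumes "cring R" "x \<in> carrier R" "1 < p * b" "2 \<le> p"
  shows "P 1 (P b x) = [(- int ((p - 1) * b - 1))] \<cdot>\<^bsub>R\<^esub> P (Suc b) x"
proof -
  interpret cring R by fact
  have "{..1 div p} = {0}" using assms(4) by auto
  then show ?thesis
    using Adem[OF assms(2,3)] assms(2) by (simp add: P_0 P_closed)
qed

end

lemma poly_var_grade: "v \<in> W \<Longrightarrow> poly_var v \<in> grade (graded_poly_ring W \<phi>) (\<phi> v)"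
  by (simp add: poly_var_def graded_poly_ring_def)

lemma ex_span_coloring_of_Steenrod:
  fixes V :: "'a set"
  assumes graph: "fin_simple_graph V E" and three: "(3 :: 'k::field) = 0"
    and S: "Steenrod_structure 3 (tensor_Zmod (B_ring n V E) 3) P"
  shows "\<exists>g :: 'a \<Rightarrow> 'k vec. span_coloring n V E g"
proof -
  let ?K = "simplicial_join (Pow {..<n}) (graph_complex V E)"
  let ?W = "B_vars n V"
  define R where "R = tensor_Zmod (SR ?W ?K B_degree) 3"
  define \<pi> where "\<pi> = tensor_SR_class ?W ?K B_degree 3"
  have finV: "finite V" using graph by (simp add: fin_simple_graph_def)
  interpret Steenrod_structure 3 R P
    using S by (simp add: B_ring_def R_def)
  have cring: "cring R"
    unfolding R_def by (intro cring_tensor_Zmod cring_SR)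
  interpret R: cring R by (rule cring)
  have \<pi>_add: "\<pi> (f + g) = \<pi> f \<oplus>\<^bsub>R\<^esub> \<pi> g" and \<pi>_mult: "\<pi> (f * g) = \<pi> f \<otimes>\<^bsub>R\<^esub> \<pi> g"
    and \<pi>_closed: "\<pi> f \<in> carrier R" if "f \<in> poly_on ?W" "g \<in> poly_on ?W" for f g
    using tensor_SR_class_simps[OF that] by (simp_all add: R_def \<pi>_def)
  have grade: "grade R d = \<pi> ` grade (B_poly n V) d" for d
    by (simp add: R_def \<pi>_def grade_tensor_SR)
  have on: "f \<in> poly_on ?W" if "f \<in> grade (B_poly n V) d" for f d
    using that grade_graded_poly_ring_sub by blast

  define is_eval where "is_eval \<xi> \<eta> e \<longleftrightarrow> ring_hom_ring R (class_ring :: 'k ring) e \<and>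
      (\<forall>f\<in>poly_on ?W. e (\<pi> f) = poly_eval (case_sum \<xi> \<eta>) f)" for \<xi> \<eta> e
  \<comment> \<open>The choice gives one family over all \<open>(\<xi>, \<eta>)\<close>; at face
    points it consists of evaluations.\<close>
  define \<epsilon> where "\<epsilon> \<xi> \<eta> = (SOME e. is_eval \<xi> \<eta> e)" for \<xi> \<eta>
  have \<epsilon>: "is_eval \<xi> \<eta> (\<epsilon> \<xi> \<eta>)" if \<eta>: "face_point V E \<eta>" for \<xi> \<eta>
  proof -
    obtain e where "ring_hom_ring R (class_ring :: 'k ring) e"
      "\<And>f. f \<in> poly_on ?W \<Longrightarrow> e (\<pi> f) = poly_eval (case_sum \<xi> \<eta>) f"
      unfolding R_def \<pi>_def
    proof (rule tensor_SR_eval)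
      show "(of_nat 3 :: 'k) = 0" using three by simp
      show "\<And>\<sigma>. \<sigma> \<subseteq> ?W \<Longrightarrow> \<sigma> \<notin> ?K \<Longrightarrow> (\<Prod>v\<in>\<sigma>. case_sum \<xi> \<eta> v) = 0"
        by (rule case_sum_nonface_vanish[OF finV \<eta>])
    qed blast
    then show ?thesis
      unfolding \<epsilon>_def by (intro someI[of "is_eval \<xi> \<eta>" e]) (simp add: is_eval_def)
  qed
  have hom: "ring_hom_ring R (class_ring :: 'k ring) (\<epsilon> \<xi> \<eta>)"
    and eval: "f \<in> poly_on ?W \<Longrightarrow> \<epsilon> \<xi> \<eta> (\<pi> f) = poly_eval (case_sum \<xi> \<eta>) f"
    if "face_point V E \<eta>" for \<xi> \<eta> f
    using \<epsilon>[OF that] by (auto simp: is_eval_def)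
  have \<epsilon>_add: "\<epsilon> \<xi> \<eta> (x \<oplus>\<^bsub>R\<^esub> y) = \<epsilon> \<xi> \<eta> x + \<epsilon> \<xi> \<eta> y"
    and \<epsilon>_mult: "\<epsilon> \<xi> \<eta> (x \<otimes>\<^bsub>R\<^esub> y) = \<epsilon> \<xi> \<eta> x * \<epsilon> \<xi> \<eta> y"
    if "face_point V E \<eta>" "x \<in> carrier R" "y \<in> carrier R" for \<xi> \<eta> x y
    using ring_hom_add[OF ring_hom_ring.homh[OF hom[OF that(1)]] that(2,3)]
      ring_hom_mult[OF ring_hom_ring.homh[OF hom[OF that(1)]] that(2,3)]
    by (simp_all only: class_ring_sel)
  have \<epsilon>_cube: "\<epsilon> \<xi> \<eta> (x [^]\<^bsub>R\<^esub> (3::nat)) = \<epsilon> \<xi> \<eta> x ^ 3"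
    if "face_point V E \<eta>" "x \<in> carrier R" for \<xi> \<eta> x
  proof -
    have "x [^]\<^bsub>R\<^esub> (3::nat) = x \<otimes>\<^bsub>R\<^esub> x \<otimes>\<^bsub>R\<^esub> x"
      using that(2) by (simp add: numeral_3_eq_3)
    then show ?thesis
      using that by (simp add: \<epsilon>_mult power3_eq_cube)
  qed

  \<comment> \<open>For p = 3 the operation P^a raises degrees by \<open>4 * a\<close>, and the
    graded pieces of \<open>R\<close> are images of homogeneous polynomials.\<close>
  have P_var: "\<exists>g\<in>grade (B_poly n V) d. P a (\<pi> (poly_var v)) = \<pi> g"
    if "v \<in> ?W" "d = B_degree v + 4 * a" for v d a
  proof -
    have "\<pi> (poly_var v) \<in> grade R (B_degree v)"
      using poly_var_grade[OF that(1)] by (auto simp: grade)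
    from P_grade[OF this, of a] show ?thesis
      by (auto simp: grade that(2) ac_simps)
  qed

  define D where "D \<xi> \<eta> f = \<epsilon> \<xi> \<eta> (P 1 (\<pi> f))" for \<xi> \<eta> f
  have var: "poly_var v \<in> poly_on ?W" if "v \<in> ?W" for v
    using that by (rule poly_on_var)

  show ?thesis
  proof (rule coloring_of_derivations[OF graph three])
    fix \<xi> :: "nat \<Rightarrow> 'k" and \<eta> :: "'a \<Rightarrow> 'k" assume \<eta>: "face_point V E \<eta>"
    show "point_derivation ?W (case_sum \<xi> \<eta>) (D \<xi> \<eta>)"
    proof
      fix f g assume fg: "f \<in> poly_on ?W" "g \<in> poly_on ?W"
      note closed = \<pi>_closed[OF fg] \<pi>_closed[OF fg(2,1)]
      show "D \<xi> \<eta> (f + g) = D \<xi> \<eta> f + D \<xi> \<eta> g"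
        using closed by (simp add: D_def \<pi>_add[OF fg] P_add \<epsilon>_add[OF \<eta>] P_closed)
      show "D \<xi> \<eta> (f * g) = poly_eval (case_sum \<xi> \<eta>) f * D \<xi> \<eta> g + D \<xi> \<eta> f * poly_eval (case_sum \<xi> \<eta>) g"
        using closed fg
        by (simp add: D_def \<pi>_mult[OF fg] P_1_mult[OF cring] \<epsilon>_add[OF \<eta>] \<epsilon>_mult[OF \<eta>] P_closed eval[OF \<eta>] del: One_nat_def)
    qed
  next
    fix i assume "i < n"
    then have v: "Inl i \<in> ?W" by auto
    let ?x = "\<pi> (poly_var (Inl i))"
    have x: "?x \<in> carrier R" by (rule \<pi>_closed[OF var[OF v] var[OF v]])
    obtain g where g: "g \<in> grade (B_poly n V) 8" "P 1 ?x = \<pi> g"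
      using P_var[OF v, of 8 1] by auto
    \<comment> \<open>As x_i has degree 4, P^2 x_i is its cube, and the Adem relation gives P^1 P^1
      = -P^2.\<close>
    have "?x \<in> grade R (2 * 2)"
      using poly_var_grade[OF v, of B_degree] by (auto simp: grade)
    then have "P 2 ?x = ?x [^]\<^bsub>R\<^esub> (3::nat)" by (rule P_top)
    then have PP: "P 1 (P 1 ?x) = [(- 1 :: int)] \<cdot>\<^bsub>R\<^esub> (?x [^]\<^bsub>R\<^esub> (3::nat))"
      using P_1_P[OF cring x, of 1] by (simp add: numeral_2_eq_2)
    show "\<exists>g\<in>grade (B_poly n V) 8. \<forall>\<xi> \<eta>. face_point V E \<eta> \<longrightarrow>
      D \<xi> \<eta> (poly_var (Inl i)) = poly_eval (case_sum \<xi> \<eta>) g \<and> D \<xi> \<eta> g = - (\<xi> i ^ 3)"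
    proof (intro bexI[OF _ g(1)] allI impI conjI)
      fix \<xi> :: "nat \<Rightarrow> 'k" and \<eta> :: "'a \<Rightarrow> 'k" assume \<eta>: "face_point V E \<eta>"
      show "D \<xi> \<eta> (poly_var (Inl i)) = poly_eval (case_sum \<xi> \<eta>) g"
        using eval[OF \<eta> on[OF g(1)]] by (simp only: D_def g(2))
      have "D \<xi> \<eta> g = \<epsilon> \<xi> \<eta> (P 1 (P 1 ?x))" by (simp only: D_def g(2))
      also have "\<dots> = of_int (- 1) * \<epsilon> \<xi> \<eta> (?x [^]\<^bsub>R\<^esub> (3::nat))"
        unfolding PP by (rule class_ring_int_multiple[OF hom[OF \<eta>]]) (simp add: x)
      also have "\<dots> = - (\<xi> i ^ 3)"
        using eval[OF \<eta> var[OF v]] by (simp add: \<epsilon>_cube[OF \<eta> x])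
      finally show "D \<xi> \<eta> g = - (\<xi> i ^ 3)" .
    qed
  next
    fix u assume "u \<in> V"
    then have v: "Inr u \<in> ?W" by auto
    let ?y = "\<pi> (poly_var (Inr u))"
    have y: "?y \<in> carrier R" by (rule \<pi>_closed[OF var[OF v] var[OF v]])
    obtain g where g: "g \<in> grade (B_poly n V) 12" "P 1 ?y = \<pi> g"
      using P_var[OF v, of 12 1] by auto
    show "\<exists>g\<in>grade (B_poly n V) 12. \<forall>\<xi> \<eta>. face_point V E \<eta> \<longrightarrow>
      D \<xi> \<eta> (poly_var (Inr u)) = poly_eval (case_sum \<xi> \<eta>) g"
      using eval[OF _ on[OF g(1)]] by (intro bexI[OF _ g(1)]) (simp only: D_def g(2), blast)
    \<comment> \<open>P^3 y_u has degree 8 + 12 = 20. As y_u has degree 8, P^4 y_u is its cube, and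
      the Adem coefficient is -(2 * 3 - 1) = -5.\<close>
    obtain h where h: "h \<in> grade (B_poly n V) 20" "P 3 ?y = \<pi> h"
      using P_var[OF v, of 20 3] by auto
    have "?y \<in> grade R (2 * 4)"
      using poly_var_grade[OF v, of B_degree] by (auto simp: grade)
    then have "P 4 ?y = ?y [^]\<^bsub>R\<^esub> (3::nat)" by (rule P_top)
    then have PP: "P 1 (P 3 ?y) = [(- 5 :: int)] \<cdot>\<^bsub>R\<^esub> (?y [^]\<^bsub>R\<^esub> (3::nat))"
      using P_1_P[OF cring y, of 3] by simp
    show "\<exists>g\<in>grade (B_poly n V) 20. \<forall>\<xi> \<eta>. face_point V E \<eta> \<longrightarrow> D \<xi> \<eta> g = - 5 * \<eta> u ^ 3"
    proof (intro bexI[OF _ h(1)] allI impI)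
      fix \<xi> :: "nat \<Rightarrow> 'k" and \<eta> :: "'a \<Rightarrow> 'k" assume \<eta>: "face_point V E \<eta>"
      have "D \<xi> \<eta> h = \<epsilon> \<xi> \<eta> (P 1 (P 3 ?y))" by (simp only: D_def h(2))
      also have "\<dots> = of_int (- 5) * \<epsilon> \<xi> \<eta> (?y [^]\<^bsub>R\<^esub> (3::nat))"
        unfolding PP by (rule class_ring_int_multiple[OF hom[OF \<eta>]]) (simp add: y)
      also have "\<dots> = - 5 * \<eta> u ^ 3"
        using eval[OF \<eta> var[OF v]] by (simp add: \<epsilon>_cube[OF \<eta> y])
      finally show "D \<xi> \<eta> h = - 5 * \<eta> u ^ 3" .
    qed
  next
    fix \<sigma> and \<xi> :: "nat \<Rightarrow> 'k" and \<eta> :: "'a \<Rightarrow> 'k"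
    assume \<sigma>: "\<sigma> \<subseteq> V" "\<sigma> \<notin> graph_complex V E" and \<eta>: "face_point V E \<eta>"
    have "(\<Prod>u\<in>\<sigma>. poly_var (Inr u :: nat + 'a)) = (\<Prod>v\<in>Inr ` \<sigma>. poly_var v)"
      by (simp add: prod.reindex)
    \<comment> \<open>The graph component of a face of the join can be read off from the face, so a
      nonface of the graph stays a nonface.\<close>
    moreover have "Inr ` \<sigma> \<notin> ?K"
    proof
      assume "Inr ` \<sigma> \<in> ?K"
      then obtain \<alpha> \<tau> where "(Inr :: 'a \<Rightarrow> nat + 'a) ` \<sigma> = Sum_Type.Plus \<alpha> \<tau>" "\<tau> \<in> graph_complex V E"
        by (auto simp: simplicial_join_def)
      moreover from this(1) have "\<sigma> = \<tau>" by (auto simp: Plus_def)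
      ultimately show False using \<sigma>(2) by simp
    qed
    moreover have "Inr ` \<sigma> \<subseteq> ?W" using \<sigma>(1) by auto
    ultimately have "\<pi> (\<Prod>u\<in>\<sigma>. poly_var (Inr u)) = \<zero>\<^bsub>R\<^esub>"
      using tensor_SR_class_nonface[of "Inr ` \<sigma>" ?W ?K B_degree 3] by (simp add: R_def \<pi>_def)
    then have "D \<xi> \<eta> (\<Prod>u\<in>\<sigma>. poly_var (Inr u)) = \<epsilon> \<xi> \<eta> \<zero>\<^bsub>R\<^esub>"
      by (simp add: D_def P_zero[OF cring])
    also have "\<dots> = 0"
      using \<epsilon>_add[OF \<eta> R.zero_closed R.zero_closed, of \<xi>]
      by (simp only: R.l_zero[OF R.zero_closed] add_cancel_right_right)
    finally show "D \<xi> \<eta> (\<Prod>u\<in>\<sigma>. poly_var (Inr u)) = 0" .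
  qed
qed

theorem theoremA:
  fixes V :: "'a set" and E :: "'a set set" and n :: nat
  assumes "fin_simple_graph V E"
    and "CARD('p::prime_card) = 3"
    and "\<exists>P. Steenrod_structure 3 (tensor_Zmod (B_ring n V E) 3) P"
  shows "span_chromatic_number TYPE('p mod_ring) V E \<le> n"
proof -
  \<comment> \<open>The field has 3 elements, and its cardinality is zero in it.\<close>
  have "(3 :: 'p mod_ring) = of_nat CARD('p)"
    unfolding assms(2) by simp
  then have "(3 :: 'p mod_ring) = 0"
    by (simp only: of_nat_card_eq_0)
  then have "\<exists>g :: 'a \<Rightarrow> 'p mod_ring vec. span_coloring n V E g"
    using ex_span_coloring_of_Steenrod[OF assms(1)] assms(3) by blast
  then show ?thesis
    unfolding span_chromatic_number_def by (rule Least_le)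
qed

end
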